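(* For all integers $m,n\ge 2$, $$\ell_3\le\frac{1}{mn}\log\rho(T_{m,n}),$$ where $\ell_3$ is the dimer constant of $\mathbb{Z}^3$, $T_{m,n}$ is the transfer matrix defined in the context, and $\rho$ denotes the spectral radius.
   Context: The cubic lattice is the graph on $\mathbb{Z}^3$ in which two vertices are adjacent if and only if they are at Euclidean distance one. For positive integers $a_1,a_2,a_3$ with $a_1a_2a_3$ even, $f(a_1,a_2,a_3)$ is the number of perfect matchings in the subgraph of the cubic lattice induced by $\{(x_1,x_2,x_3)\in\mathbb{Z}^3 : 0\le x_i<a_i,\ i=1,2,3\}$. The dimer constant is $\ell_3:=\lim \frac{1}{a_1a_2a_3}\log f(a_1,a_2,a_3)$, the limit being over $a_1,a_2,a_3\to\infty$ with $a_1a_2a_3$ even ($\log$ is the natural logarithm); this limit is known to exist and to be independent of the sequence taken (Hammersley, 1966). For integers $m,n\ge2$, let $V_{m,n}:=\mathbb{Z}/m\mathbb{Z}\times\mathbb{Z}/n\mathbb{Z}$ with componentwise addition. The matrix $A_{m,n}$, with rows and columns indexed by $V_{m,n}$, has entries $A_{m,n}(\mathbf{u},\mathbf{v})=1$ if $\mathbf{v}-\mathbf{u}\in\{(0,0),(1,0),(0,1)\}$ and $0$ otherwise. For $R,C\subseteq V_{m,n}$, $A_{m,n}[R,C]$ is the submatrix with row set $R$ and column set $C$. The matrix $T_{m,n}$, with rows and columns indexed by the power set of $V_{m,n}$, has entries $$T_{m,n}(U,V):=\begin{cases}\operatorname{per}A_{m,n}[U,V_{m,n}\setminus V] & \text{if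 }|U|+|V|=mn,\\ 0&\text{otherwise,}\end{cases}$$ where for $|R|=|C|$, $\operatorname{per}A_{m,n}[R,C]=\sum_{\sigma:R\to C\text{ bijection}}\prod_{\mathbf{u}\in R}A_{m,n}(\mathbf{u},\sigma(\mathbf{u}))$ is the permanent, and the permanent of the empty matrix is $1$. *)

theory Defs
  imports "HOL-Analysis.Analysis" "Jordan_Normal_Form.Spectral_Radius"
begin

section \<open>The dimer constant of the cubic lattice\<close>

definition real_point :: "int \<times> int \<times> int \<Rightarrow> real \<times> real \<times> real" where
  "real_point = (\<lambda>(x1, x2, x3). (real_of_int x1, real_of_int x2, real_of_int x3))"

text \<open>\<^const>\<open>dist\<close> on \<^typ>\<open>real \<times> real \<times> real\<close> is the Euclidean distance.\<close>

definition cubic_lattice_edges :: "(int \<times> int \<times> int) set set" where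
  "cubic_lattice_edges = {{x, y} |x y. dist (real_point x) (real_point y) = 1}"

definition induced_edges :: "'a set set \<Rightarrow> 'a set \<Rightarrow> 'a set set" where
  "induced_edges E S = {e \<in> E. e \<subseteq> S}"

definition perfect_matchings :: "'a set \<Rightarrow> 'a set set \<Rightarrow> 'a set set set" where
  "perfect_matchings S E = {M. M \<subseteq> E \<and> (\<forall>v\<in>S. \<exists>!e. e \<in> M \<and> v \<in> e)}"

definition lattice_box :: "nat \<Rightarrow> nat \<Rightarrow> nat \<Rightarrow> (int \<times> int \<times> int) set" where
  "lattice_box a1 a2 a3 = {0..<int a1} \<times> {0..<int a2} \<times> {0..<int a3}"

definition num_dimer_coverings :: "nat \<Rightarrow> nat \<Rightarrow> nat \<Rightarrow> nat" where
  "num_dimer_coverings a1 a2 a3 =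
     card (perfect_matchings (lattice_box a1 a2 a3)
             (induced_edges cubic_lattice_edges (lattice_box a1 a2 a3)))"

text \<open>The limit is taken along the filter in which all three side lengths tend to infinity
  independently of each other, restricted to boxes of even volume.
  It exists by a theorem of Hammersley, so that \<^const>\<open>Lim\<close> denotes it.\<close>

definition dimer_constant :: real where
  "dimer_constant =
     Lim (inf (at_top \<times>\<^sub>F at_top \<times>\<^sub>F at_top) (principal {(a1, a2, a3). even (a1 * a2 * a3)}))
       (\<lambda>(a1, a2, a3). 1 / real (a1 * a2 * a3) * ln (real (num_dimer_coverings a1 a2 a3)))"


section \<open>The transfer matrix\<close>

text \<open>Elements of $Z/mZ \times Z/nZ$ are represented by their least nonnegative residues.\<close>

definition torus :: "nat \<Rightarrow> nat \<Rightarrow> (int \<times> int) set" where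
  "torus m n = {0..<int m} \<times> {0..<int n}"

definition torus_diff :: "nat \<Rightarrow> nat \<Rightarrow> int \<times> int \<Rightarrow> int \<times> int \<Rightarrow> int \<times> int" where
  "torus_diff m n v u = ((fst v - fst u) mod int m, (snd v - snd u) mod int n)"

definition torus_matrix :: "nat \<Rightarrow> nat \<Rightarrow> int \<times> int \<Rightarrow> int \<times> int \<Rightarrow> nat" where
  "torus_matrix m n u v = (if torus_diff m n v u \<in> {(0, 0), (1, 0), (0, 1)} then 1 else 0)"

text \<open>The permanent of the submatrix \<open>A[R, C]\<close>, meant for finite \<open>R\<close> and \<open>C\<close> of equal
  cardinality. Bijections are taken extensional on \<open>R\<close>, so that each of them is counted once.\<close>

definition permanent :: "('a \<Rightarrow> 'b \<Rightarrow> 'c :: comm_semiring_1) \<Rightarrow> 'a set \<Rightarrow> 'b set \<Rightarrow> 'c" where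
  "permanent A R C = (\<Sum>\<sigma> \<in> {\<sigma> \<in> R \<rightarrow>\<^sub>E C. bij_betw \<sigma> R C}. \<Prod>u\<in>R. A u (\<sigma> u))"

definition transfer_entry :: "nat \<Rightarrow> nat \<Rightarrow> (int \<times> int) set \<Rightarrow> (int \<times> int) set \<Rightarrow> nat" where
  "transfer_entry m n U V =
     (if card U + card V = m * n then permanent (torus_matrix m n) U (torus m n - V) else 0)"

text \<open>A matrix whose rows and columns are indexed by a finite set \<open>I\<close>. For finite \<open>I\<close>,
  \<^term>\<open>from_nat_into I\<close> is a bijection from \<^term>\<open>{..<card I}\<close> onto \<open>I\<close>; a different
  enumeration conjugates the result by a permutation matrix and leaves the spectrum unchanged.\<close>

definition mat_of_set :: "'i set \<Rightarrow> ('i \<Rightarrow> 'i \<Rightarrow> 'a) \<Rightarrow> 'a mat" where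
  "mat_of_set I f =
     mat (card I) (card I) (\<lambda>(i, j). f (from_nat_into I i) (from_nat_into I j))"

definition transfer_matrix :: "nat \<Rightarrow> nat \<Rightarrow> complex mat" where
  "transfer_matrix m n = mat_of_set (Pow (torus m n)) (\<lambda>U V. of_nat (transfer_entry m n U V))"

end

theory Submission
  imports Defs
begin

text \<open>
  The idea is to slice the lattice along the planes \<open>x + y + z = k\<close>. Projected to the first two
  coordinates, every such plane becomes \<open>Z\<^sup>2\<close>, and the upward edges from level \<open>k\<close> to level \<open>k + 1\<close>
  shift by \<open>(0, 0)\<close>, \<open>(1, 0)\<close> or \<open>(0, 1)\<close>. Reducing the plane modulo \<open>m\<close> and \<open>n\<close> and the level
  modulo \<open>L\<close> gives a finite graph, a torus with a twist. If the states of a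
  matching are the sets of vertices of each level that are matched upwards, then the entries of the
  transfer matrix \<open>T\<close> count the sets of edges between consecutive levels with given states, so the
  torus has at most \<open>tr T\<^sup>L\<close> perfect matchings, and this is at most \<open>c t\<^sup>L\<close> for every \<open>t\<close> above the spectral radius
  (\<open>torus_count_exponential_bound\<close>).

  A box of size \<open>m, n, L\<close> embeds into the torus with the same parameters, covering all its vertices,
  so it has at most as many coverings as the torus has matchings. What remains is to bound large
  tori by small ones. For even \<open>L\<close> the torus is bipartite, and the torus with \<open>m\<close> or \<open>n\<close> doubled is a
  double cover of it. A double cover \<open>H\<close> of a bipartite graph \<open>G\<close> has at most as many perfect
  matchings as two disjoint copies of \<open>G\<close> (\<open>card_matchings_double_cover_le\<close>). Indeed, a perfect
  matching of either cover projects to a multigraph in \<open>G\<close> in which all vertices have degree two; once the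
  projection is fixed, the lifts solve a linear system over the field with two elements whose
  homogeneous part does not depend on the cover, and for two disjoint copies the system is
  solvable because cycles in a bipartite graph are even. Iterating, the number of coverings of the
  box \<open>m 2\<^sup>i, n 2\<^sup>i, L\<close> is at most \<open>(c t\<^sup>L)\<close> to the power \<open>4\<^sup>i\<close>, and with \<open>L = 2\<^bsup>i+1\<^esup>\<close> its density,
  the logarithm of the number of coverings divided by the volume, tends to at most \<open>ln t / (m n)\<close>.

  Finally, \<open>Lim\<close> has a meaning only if the limit exists. Packing a large box with copies of a
  fixed box shows that the density converges to its supremum over all boxes with even sides
  (\<open>dimer_constant_le\<close>), and the same packing applied to the boxes above shows that each of these
  densities is at most \<open>ln t / (m n)\<close>. Letting \<open>t\<close> tend to the spectral radius gives the theorem.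
\<close>

section \<open>Perfect matchings of incidence structures\<close>

text \<open>Edges are arbitrary objects with an incidence relation. This admits edges that are sets of two
  vertices, as in the lattice, as well as the labelled edges of tori and of covering graphs, without
  having to choose between graphs and multigraphs.\<close>

definition matchings :: "'v set \<Rightarrow> 'e set \<Rightarrow> ('v \<Rightarrow> 'e \<Rightarrow> bool) \<Rightarrow> 'e set set" where
  "matchings V E inc = {M. M \<subseteq> E \<and> (\<forall>v\<in>V. \<exists>!e. e \<in> M \<and> inc v e)}"

lemma perfect_matchings_eq_matchings: "perfect_matchings V E = matchings V E (\<lambda>v e. v \<in> e)"
  by (simp add: perfect_matchings_def matchings_def)

lemma finite_matchings: "finite E \<Longrightarrow> finite (matchings V E inc)"
  by (rule finite_subset[of _ "Pow E"]) (auto simp: matchings_def)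

text \<open>Adding edges to a graph, without new vertices, cannot destroy perfect matchings: the image of a
  matching under \<open>h\<close> is again one.\<close>

lemma card_matchings_le_embedding:
  assumes fin: "finite E2" and inj: "inj_on h E1" and im: "h ` E1 \<subseteq> E2" and V2: "V2 \<subseteq> f ` V1"
    and inc: "\<And>v e. v \<in> V1 \<Longrightarrow> e \<in> E1 \<Longrightarrow> inc2 (f v) (h e) \<longleftrightarrow> inc1 v e"
  shows "card (matchings V1 E1 inc1) \<le> card (matchings V2 E2 inc2)"
proof (rule card_inj_on_le[of "(`) h"])
  show "inj_on ((`) h) (matchings V1 E1 inc1)"
    by (rule inj_on_subset[OF inj_on_image_Pow[OF inj]]) (auto simp: matchings_def)
  show "(`) h ` matchings V1 E1 inc1 \<subseteq> matchings V2 E2 inc2"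
  proof (rule image_subsetI)
    fix M assume M: "M \<in> matchings V1 E1 inc1"
    have ME: "M \<subseteq> E1" using M by (simp add: matchings_def)
    have "\<exists>!e. e \<in> h ` M \<and> inc2 v2 e" if v2: "v2 \<in> V2" for v2
    proof -
      obtain v where v: "v \<in> V1" "v2 = f v" using v2 V2 by auto
      then obtain e where e: "e \<in> M" "inc1 v e" "\<And>e'. e' \<in> M \<Longrightarrow> inc1 v e' \<Longrightarrow> e' = e"
        using M unfolding matchings_def by blast
      show ?thesis
      proof (rule ex1I[of _ "h e"])
        show "h e \<in> h ` M \<and> inc2 v2 (h e)" using e(1,2) ME v inc[of v e] by auto
        fix e2 assume "e2 \<in> h ` M \<and> inc2 v2 e2"
        then obtain e' where e': "e' \<in> M" "e2 = h e'" "inc2 v2 (h e')" by auto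
        then have "inc1 v e'" using inc[of v e'] v ME by auto
        then show "e2 = h e" using e(3) e' by auto
      qed
    qed
    then show "h ` M \<in> matchings V2 E2 inc2"
      using image_mono[OF ME, of h] im by (simp add: matchings_def)
  qed
qed (rule finite_matchings[OF fin])

section \<open>Double covers of bipartite graphs\<close>

text \<open>Joining every \<open>e\<close> to \<open>t e\<close> and to \<open>k e\<close> gives the union of two perfect matchings of \<open>E\<close>, which consists
  of even cycles, and \<open>X\<close> is one class of a proper colouring with two colours. Instead of following cycles, the induction contracts a pair
  \<open>{e, t e}\<close>: the partners of \<open>e\<close> and \<open>t e\<close> under \<open>k\<close> become partners of each other.\<close>

lemma two_involutions_coloring:
  assumes "finite E"
    and "\<And>e. e \<in> E \<Longrightarrow> t e \<in> E \<and> t e \<noteq> e \<and> t (t e) = e"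
    and "\<And>e. e \<in> E \<Longrightarrow> k e \<in> E \<and> k e \<noteq> e \<and> k (k e) = e"
  shows "\<exists>X. \<forall>e\<in>E. (t e \<in> X \<longleftrightarrow> e \<notin> X) \<and> (k e \<in> X \<longleftrightarrow> e \<notin> X)"
  using assms
proof (induction "card E" arbitrary: E k rule: less_induct)
  case less
  note t = less.prems(2) and k = less.prems(3)
  show ?case
  proof (cases "E = {}")
    case False
    then obtain e where e: "e \<in> E" by auto
    define F where "F = E - {e, t e}"
    have card: "card F < card E"
      unfolding F_def by (rule psubset_card_mono) (use e less.prems(1) in auto)
    have finF: "finite F" using less.prems(1) by (simp add: F_def)
    have tF: "t f \<in> F \<and> t f \<noteq> f \<and> t (t f) = f" if "f \<in> F" for f
      using that t e unfolding F_def by (metis Diff_iff insertCI insertE empty_iff)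
    show ?thesis
    proof (cases "k e = t e")
      case True
      have kF: "k f \<in> F \<and> k f \<noteq> f \<and> k (k f) = f" if "f \<in> F" for f
        using that t k e True unfolding F_def by (metis Diff_iff insertCI insertE empty_iff)
      obtain X where X: "\<forall>f\<in>F. (t f \<in> X \<longleftrightarrow> f \<notin> X) \<and> (k f \<in> X \<longleftrightarrow> f \<notin> X)"
        using less.hyps[OF card finF tF kF] by auto
      have kt: "k (t e) = e" using k e True by metis
      define Y where "Y = insert e (X \<inter> F)"
      have te: "t e \<noteq> e" "t (t e) = e" using t[OF e] by auto
      have Ye: "e \<in> Y" "t e \<notin> Y" using te(1) by (auto simp: Y_def F_def)
      have YF: "f \<in> Y \<longleftrightarrow> f \<in> X" if "f \<in> F" for f
        using that by (auto simp: Y_def F_def)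
      have "(t f \<in> Y \<longleftrightarrow> f \<notin> Y) \<and> (k f \<in> Y \<longleftrightarrow> f \<notin> Y)" if f: "f \<in> E" for f
      proof -
        consider "f = e" | "f = t e" | "f \<in> F" using f by (auto simp: F_def)
        then show ?thesis
        proof cases
          case 1 then show ?thesis using Ye True by auto
        next
          case 2 then show ?thesis using Ye te(2) kt by auto
        next
          case 3
          then have "t f \<in> F" "k f \<in> F" using tF kF by auto
          then show ?thesis using YF[of f] YF[of "t f"] YF[of "k f"] bspec[OF X 3] 3 by simp
        qed
      qed
      then show ?thesis by blast
    next
      case False
      define a b where "a = k e" and "b = k (t e)"
      have te: "t e \<in> E" "t e \<noteq> e" "t (t e) = e" using t[OF e] by auto
      note ke = k[OF e] k[OF te(1)]
      have a: "a \<in> F" "k a = e" and b: "b \<in> F" "k b = t e" and ab: "a \<noteq> b"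
        unfolding a_def b_def F_def using ke te e False by auto
      \<comment> \<open>After removing \<open>e\<close> and \<open>t e\<close>, their \<open>k\<close>-partners \<open>a\<close> and \<open>b\<close> are left over and are paired.\<close>
      define k' where "k' f = (if f = a then b else if f = b then a else k f)" for f
      have kF: "k' f \<in> F \<and> k' f \<noteq> f \<and> k' (k' f) = f" if f: "f \<in> F" for f
      proof -
        have "k f \<in> F" if "f \<noteq> a" "f \<noteq> b"
          using that f k[of f] a_def b_def unfolding F_def by (metis Diff_iff insertCI insertE empty_iff)
        moreover have "k f \<noteq> a" "k f \<noteq> b"
          using f k[of f] a b unfolding F_def by auto
        moreover have "k f \<noteq> f" "k (k f) = f" using k[of f] f unfolding F_def by auto
        ultimately show ?thesis using a b ab unfolding k'_def by auto
      qed
      obtain X where X: "\<forall>f\<in>F. (t f \<in> X \<longleftrightarrow> f \<notin> X) \<and> (k' f \<in> X \<longleftrightarrow> f \<notin> X)"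
        using less.hyps[OF card finF tF kF] by auto
      have abX: "b \<in> X \<longleftrightarrow> a \<notin> X" using bspec[OF X a(1)] by (simp add: k'_def)
      define Y where "Y = (X \<inter> F) \<union> (if a \<in> X then {t e} else {e})"
      have YF: "f \<in> Y \<longleftrightarrow> f \<in> X" if "f \<in> F" for f
        using that by (auto simp: Y_def F_def)
      have Ye: "e \<in> Y \<longleftrightarrow> a \<notin> X" "t e \<in> Y \<longleftrightarrow> a \<in> X"
        using te by (auto simp: Y_def F_def)
      have "(t f \<in> Y \<longleftrightarrow> f \<notin> Y) \<and> (k f \<in> Y \<longleftrightarrow> f \<notin> Y)" if f: "f \<in> E" for f
      proof -
        consider "f = e" | "f = t e" | "f = a" | "f = b" | "f \<in> F" "f \<noteq> a" "f \<noteq> b"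
          using f by (auto simp: F_def)
        then show ?thesis
        proof cases
          case 1 then show ?thesis using Ye YF[OF a(1)] a_def by simp
        next
          case 2 then show ?thesis using Ye YF[OF b(1)] b_def te abX by simp
        next
          case 3 then show ?thesis using Ye YF[OF a(1)] YF[of "t a"] a bspec[OF X a(1)] tF[OF a(1)] by simp
        next
          case 4 then show ?thesis using Ye YF[OF b(1)] YF[of "t b"] b bspec[OF X b(1)] tF[OF b(1)] abX by simp
        next
          case 5
          then have "k' f = k f" by (simp add: k'_def)
          then show ?thesis using YF[of f] YF[of "t f"] YF[of "k f"] bspec[OF X 5(1)] tF[OF 5(1)] kF[OF 5(1)] 5(1) by simp
        qed
      qed
      then show ?thesis by blast
    qed
  qed auto
qed

text \<open>The double cover with voltages \<open>g\<close>: every vertex and every edge has two copies, and copy \<open>r\<close> of \<open>e\<close>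
  ends at copy \<open>s\<close> of its end \<open>v\<close>, where \<open>r\<close> and \<open>s\<close> differ iff \<open>g v e\<close>. The voltage zero gives two disjoint
  copies of the graph.\<close>

definition lift_inc :: "('v \<Rightarrow> 'e \<Rightarrow> bool) \<Rightarrow> ('v \<Rightarrow> 'e \<Rightarrow> bool) \<Rightarrow> 'v \<times> bool \<Rightarrow> 'e \<times> bool \<Rightarrow> bool" where
  "lift_inc inc g = (\<lambda>(v, s) (e, r). inc v e \<and> r = (s \<noteq> g v e))"

text \<open>The edges which the projection of \<open>M\<close> to the base graph uses with multiplicity one and two.\<close>

definition once :: "('e \<times> bool) set \<Rightarrow> 'e set" where
  "once M = {e. ((e, True) \<in> M) \<noteq> ((e, False) \<in> M)}"

definition twice :: "('e \<times> bool) set \<Rightarrow> 'e set" where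
  "twice M = {e. (e, True) \<in> M \<and> (e, False) \<in> M}"

text \<open>The two copies of a vertex are covered either by both copies of one edge, or by copies of two
  different edges. In the second case the edge at copy \<open>False\<close> of the vertex is \<open>e\<close> and the one at copy
  \<open>True\<close> is \<open>f\<close>, which fixes the copies in terms of the voltages.\<close>

lemma lift_matching_at_vertex:
  assumes M: "M \<in> matchings (V \<times> UNIV) (E \<times> UNIV) (lift_inc inc g)" and v: "v \<in> V"
  obtains (double) e where "e \<in> twice M" "inc v e" "\<And>f. f \<in> once M \<union> twice M \<Longrightarrow> inc v f \<Longrightarrow> f = e"
  | (pair) e f where "e \<in> once M" "f \<in> once M" "e \<noteq> f" "inc v e" "inc v f"
      "\<And>f'. f' \<in> once M \<union> twice M \<Longrightarrow> inc v f' \<Longrightarrow> f' = e \<or> f' = f"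
      "(e, True) \<in> M \<longleftrightarrow> g v e" "(f, True) \<in> M \<longleftrightarrow> \<not> g v f"
proof -
  have ex: "\<exists>!e. (e, s \<noteq> g v e) \<in> M \<and> inc v e" for s
  proof -
    have "\<exists>!p. p \<in> M \<and> lift_inc inc g (v, s) p"
      using M v unfolding matchings_def by blast
    then show ?thesis unfolding lift_inc_def by (auto; metis)
  qed
  obtain e where e: "(e, g v e) \<in> M" "inc v e" "\<And>e'. (e', g v e') \<in> M \<Longrightarrow> inc v e' \<Longrightarrow> e' = e"
    using ex[of False] by auto
  obtain f where f: "(f, \<not> g v f) \<in> M" "inc v f" "\<And>e'. (e', \<not> g v e') \<in> M \<Longrightarrow> inc v e' \<Longrightarrow> e' = f"
    using ex[of True] by auto
  have only: "f' = e \<or> f' = f" if "f' \<in> once M \<union> twice M" "inc v f'" for f'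
    using that e(3)[of f'] f(3)[of f'] unfolding once_def twice_def
    by (cases "g v f'") auto
  show thesis
  proof (cases "e = f")
    case True
    have "e \<in> twice M" using e(1) f(1) True unfolding twice_def by (cases "g v e") auto
    then show thesis using double e(2) only True by blast
  next
    case False
    have "(e, \<not> g v e) \<notin> M" "(f, g v f) \<notin> M" using f(3)[of e] e(2) e(3)[of f] f(2) False by auto
    then have "e \<in> once M" "f \<in> once M" "(e, True) \<in> M \<longleftrightarrow> g v e" "(f, True) \<in> M \<longleftrightarrow> \<not> g v f"
      using e(1) f(1) unfolding once_def by (cases "g v e"; cases "g v f"; simp)+
    then show thesis using pair False e(2) f(2) only by blast
  qed
qed

text \<open>Two edges of \<open>once M\<close> which share an end have different colours. This is where the base graph has
  to be bipartite: the edges of \<open>once M\<close> are paired up at their ends in \<open>B\<close> and again at their ends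
  in \<open>W\<close>, which are the two involutions to be coloured.\<close>

lemma alternating_coloring_of_once:
  assumes fin: "finite E"
    and B: "\<And>e. e \<in> E \<Longrightarrow> \<exists>!v. v \<in> B \<and> inc v e"
    and W: "\<And>e. e \<in> E \<Longrightarrow> \<exists>!v. v \<in> W \<and> inc v e"
    and M: "M \<in> matchings ((B \<union> W) \<times> UNIV) (E \<times> UNIV) (lift_inc inc g)"
  shows "\<exists>Y. \<forall>v\<in>B \<union> W. \<forall>e\<in>once M. \<forall>f\<in>once M. inc v e \<longrightarrow> inc v f \<longrightarrow> e \<noteq> f \<longrightarrow> (e \<in> Y \<longleftrightarrow> f \<notin> Y)"
proof -
  have sub: "once M \<subseteq> E" using M by (auto simp: once_def matchings_def)
  have mate: "\<exists>t. \<forall>e\<in>once M. t e \<in> once M \<and> t e \<noteq> e \<and> t (t e) = e \<and>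
      (\<forall>v\<in>U. \<forall>f\<in>once M. inc v e \<longrightarrow> inc v f \<longrightarrow> e \<noteq> f \<longrightarrow> f = t e)"
    if U: "U \<subseteq> B \<union> W" and ex1: "\<And>e. e \<in> E \<Longrightarrow> \<exists>!v. v \<in> U \<and> inc v e" for U
  proof -
    define adj where "adj e f \<longleftrightarrow> f \<in> once M \<and> f \<noteq> e \<and> (\<exists>v\<in>U. inc v e \<and> inc v f)" for e f
    have adj: "\<exists>!f. adj e f" if e: "e \<in> once M" for e
    proof -
      obtain v where v: "v \<in> U" "inc v e" "\<And>w. w \<in> U \<Longrightarrow> inc w e \<Longrightarrow> w = v"
        using ex1 e sub by blast
      have v': "v \<in> B \<union> W" using v(1) U by auto
      show ?thesis
      proof (cases rule: lift_matching_at_vertex[OF M v', case_names double pair])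
        case (double f)
        then show ?thesis using e v(2) by (auto simp: once_def twice_def)
      next
        case (pair f f')
        then have "e = f \<or> e = f'" using e v(2) by blast
        then show ?thesis using pair v e unfolding adj_def by (metis UnI1)
      qed
    qed
    define t where "t e = (THE f. adj e f)" for e
    have t: "adj e (t e)" if "e \<in> once M" for e
      unfolding t_def by (rule theI') (rule adj[OF that])
    have uniq: "f = t e" if "e \<in> once M" "adj e f" for e f
      using adj[OF that(1)] t[OF that(1)] that(2) by auto
    show ?thesis
    proof (intro exI[of _ t] ballI conjI impI)
      fix e assume e: "e \<in> once M"
      show "t e \<in> once M" "t e \<noteq> e" using t[OF e] by (auto simp: adj_def)
      have "adj (t e) e" using t[OF e] e by (auto simp: adj_def)
      then show "t (t e) = e" using uniq[OF \<open>t e \<in> once M\<close>] by auto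
      fix v f assume "v \<in> U" "f \<in> once M" "inc v e" "inc v f" "e \<noteq> f"
      then show "f = t e" by (intro uniq[OF e]) (auto simp: adj_def)
    qed
  qed
  obtain t where t: "\<forall>e\<in>once M. t e \<in> once M \<and> t e \<noteq> e \<and> t (t e) = e \<and>
      (\<forall>v\<in>B. \<forall>f\<in>once M. inc v e \<longrightarrow> inc v f \<longrightarrow> e \<noteq> f \<longrightarrow> f = t e)"
    using mate[of B] B by auto
  obtain k where k: "\<forall>e\<in>once M. k e \<in> once M \<and> k e \<noteq> e \<and> k (k e) = e \<and>
      (\<forall>v\<in>W. \<forall>f\<in>once M. inc v e \<longrightarrow> inc v f \<longrightarrow> e \<noteq> f \<longrightarrow> f = k e)"
    using mate[of W] W by auto
  obtain Y where Y: "\<forall>e\<in>once M. (t e \<in> Y \<longleftrightarrow> e \<notin> Y) \<and> (k e \<in> Y \<longleftrightarrow> e \<notin> Y)"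
    using two_involutions_coloring[of "once M" t k] t k finite_subset[OF sub fin] by auto
  show ?thesis
    by (rule exI[of _ Y]) (use t k Y in blast)
qed

text \<open>A matching \<open>M\<close> of the cover is determined by \<open>once M\<close>, \<open>twice M\<close> and the set \<open>upper M\<close> of edges whose
  copy \<open>True\<close> is used. At a vertex with two edges of \<open>once M\<close>, whether exactly one of them lies in
  \<open>upper M\<close> depends on the voltages only. Hence the sum modulo two of \<open>upper M\<close> and the same set for a
  reference matching with the same projection takes equal values at the two edges, and adding an
  alternating colouring makes the values different. The result splits \<open>once M\<close> into two parts,
  each of which together with \<open>twice M\<close> is a perfect matching of the base graph. Since the reference
  matching and the colouring depend on the projection only, \<open>M\<close> can be recovered.\<close>

lemma card_matchings_double_cover_le:
  fixes inc :: "'v \<Rightarrow> 'e \<Rightarrow> bool"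
  assumes fin: "finite E"
    and B: "\<And>e. e \<in> E \<Longrightarrow> \<exists>!v. v \<in> B \<and> inc v e"
    and W: "\<And>e. e \<in> E \<Longrightarrow> \<exists>!v. v \<in> W \<and> inc v e"
  shows "card (matchings ((B \<union> W) \<times> UNIV) (E \<times> UNIV) (lift_inc inc g))
    \<le> (card (matchings (B \<union> W) E inc))\<^sup>2"
proof -
  let ?L = "matchings ((B \<union> W) \<times> UNIV) (E \<times> UNIV) (lift_inc inc g)"
  let ?G = "matchings (B \<union> W) E inc"
  define upper where "upper M = {e. (e, True) \<in> M}" for M :: "('e \<times> bool) set"
  \<comment> \<open>A reference matching and an alternating colouring for each projection.\<close>
  define base where "base S D = (SOME M. M \<in> ?L \<and> once M = S \<and> twice M = D)" for S D :: "'e set"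
  define alt where "alt S = (SOME Y. \<forall>v\<in>B \<union> W. \<forall>e\<in>S. \<forall>f\<in>S. inc v e \<longrightarrow> inc v f \<longrightarrow> e \<noteq> f
    \<longrightarrow> (e \<in> Y \<longleftrightarrow> f \<notin> Y))" for S
  \<comment> \<open>Two nested equivalences form the sum modulo two of three truth values.\<close>
  define chi where "chi M = {e \<in> once M. (e \<in> upper M) = ((e \<in> upper (base (once M) (twice M))) = (e \<in> alt (once M)))}" for M
  define \<Phi> where "\<Phi> M = (twice M \<union> chi M, twice M \<union> (once M - chi M))" for M
  have base: "base (once M) (twice M) \<in> ?L" "once (base (once M) (twice M)) = once M"
    "twice (base (once M) (twice M)) = twice M" if "M \<in> ?L" for M
    using someI[of "\<lambda>N. N \<in> ?L \<and> once N = once M \<and> twice N = twice M" M] that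
    unfolding base_def by auto
  have chi_alt: "e \<in> chi M \<longleftrightarrow> f \<notin> chi M"
    if M: "M \<in> ?L" and v: "v \<in> B \<union> W" "e \<in> once M" "f \<in> once M" "inc v e" "inc v f" "e \<noteq> f" for M v e f
  proof -
    have opposite: "(e \<in> upper N \<longleftrightarrow> f \<in> upper N) \<longleftrightarrow> (g v e \<longleftrightarrow> \<not> g v f)"
      if N: "N \<in> ?L" "once N = once M" for N
    proof (cases rule: lift_matching_at_vertex[OF N(1) v(1), case_names double pair])
      case (double e')
      then show ?thesis using v N by (metis UnI1)
    next
      case (pair e' f')
      then show ?thesis using v N unfolding upper_def by (metis UnI1 mem_Collect_eq)
    qed
    have "e \<in> alt (once M) \<longleftrightarrow> f \<notin> alt (once M)"
      using someI_ex[OF alternating_coloring_of_once[OF fin B W M], folded alt_def] v by blast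
    then show ?thesis
      using opposite[OF M refl] opposite[OF base(1,2)[OF M]] v unfolding chi_def by auto
  qed
  have chi_sub: "chi M \<subseteq> once M" for M by (auto simp: chi_def)
  have disj: "once M \<inter> twice M = {}" for M :: "('e \<times> bool) set" by (auto simp: once_def twice_def)
  have mem: "twice M \<union> X \<in> ?G"
    if M: "M \<in> ?L" and X: "X = chi M \<or> X = once M - chi M" for M X
  proof -
    have XM: "X \<subseteq> once M" using X chi_sub by blast
    have "\<exists>!e. e \<in> twice M \<union> X \<and> inc v e" if v: "v \<in> B \<union> W" for v
    proof (cases rule: lift_matching_at_vertex[OF M v, case_names double pair])
      case (double e)
      then show ?thesis using XM by blast
    next
      case (pair e f)
      have ef: "e \<in> X \<longleftrightarrow> f \<notin> X"
        using chi_alt[OF M v pair(1,2,4,5,3)] pair(1,2) X by blast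
      have tw: "e \<notin> twice M" "f \<notin> twice M" using pair(1,2) disj by blast+
      have only: "e' = e \<or> e' = f" if "e' \<in> twice M \<union> X" "inc v e'" for e'
        using pair(6)[of e'] that XM by blast
      show ?thesis
      proof (cases "e \<in> X")
        case True
        then show ?thesis using only ef tw pair(4) by blast
      next
        case False
        then show ?thesis using only ef tw pair(5) by blast
      qed
    qed
    moreover have "twice M \<union> X \<subseteq> E"
      using M X chi_sub by (auto simp: matchings_def once_def twice_def)
    ultimately show ?thesis by (auto simp: matchings_def)
  qed
  have "card ?L \<le> card (?G \<times> ?G)"
  proof (rule card_inj_on_le[of \<Phi>])
    show "\<Phi> ` ?L \<subseteq> ?G \<times> ?G" using mem unfolding \<Phi>_def by auto
    show "finite (?G \<times> ?G)" using finite_matchings[OF fin] by auto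
    show "inj_on \<Phi> ?L"
    proof (rule inj_onI)
      fix M N assume MN: "M \<in> ?L" "N \<in> ?L" "\<Phi> M = \<Phi> N"
      have recover: "twice M = fst (\<Phi> M) \<inter> snd (\<Phi> M)" "chi M = fst (\<Phi> M) - snd (\<Phi> M)"
        "once M = (fst (\<Phi> M) - snd (\<Phi> M)) \<union> (snd (\<Phi> M) - fst (\<Phi> M))" for M
        using disj[of M] chi_sub[of M] unfolding \<Phi>_def by auto
      have tw: "twice M = twice N" and ch: "chi M = chi N" and on: "once M = once N"
        using MN(3) recover[of M] recover[of N] by simp_all
      have up: "e \<in> upper M \<longleftrightarrow> e \<in> upper N" if "e \<in> once M" for e
        using that ch unfolding chi_def on tw by auto
      have "(e, s) \<in> M \<longleftrightarrow> (e, s) \<in> N" for e s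
        using up[of e] on tw unfolding upper_def once_def twice_def set_eq_iff mem_Collect_eq
        by (cases s) metis+
      then show "M = N" by auto
    qed
  qed
  then show ?thesis by (simp add: card_cartesian_product power2_eq_square)
qed

section \<open>Dimer coverings of boxes are supermultiplicative\<close>

lemma cubic_lattice_edges_iff:
  "{(x, y, z), (x', y', z')} \<in> cubic_lattice_edges \<longleftrightarrow> (x - x')\<^sup>2 + (y - y')\<^sup>2 + (z - z')\<^sup>2 = 1"
proof -
  have *: "dist (real_point (a, b, c)) (real_point (a', b', c')) = 1 \<longleftrightarrow>
      (a - a')\<^sup>2 + (b - b')\<^sup>2 + (c - c')\<^sup>2 = 1" for a b c a' b' c'
  proof -
    have "dist (real_point (a, b, c)) (real_point (a', b', c'))
        = sqrt (real_of_int ((a - a')\<^sup>2 + (b - b')\<^sup>2 + (c - c')\<^sup>2))"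
      by (simp add: real_point_def dist_Pair_Pair dist_real_def)
    then show ?thesis by (simp only: real_sqrt_eq_1_iff of_int_eq_1_iff)
  qed
  show ?thesis
  proof
    assume "{(x, y, z), (x', y', z')} \<in> cubic_lattice_edges"
    then obtain p q where pq: "{(x, y, z), (x', y', z')} = {p, q}"
        "dist (real_point p) (real_point q) = 1"
      unfolding cubic_lattice_edges_def by auto
    then have "dist (real_point (x, y, z)) (real_point (x', y', z')) = 1"
      by (auto simp: doubleton_eq_iff dist_commute)
    then show "(x - x')\<^sup>2 + (y - y')\<^sup>2 + (z - z')\<^sup>2 = 1" by (simp only: *)
  next
    assume "(x - x')\<^sup>2 + (y - y')\<^sup>2 + (z - z')\<^sup>2 = 1"
    then show "{(x, y, z), (x', y', z')} \<in> cubic_lattice_edges"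
      unfolding cubic_lattice_edges_def using * by blast
  qed
qed

text \<open>The orientation of the edges by the level \<open>x + y + z\<close>, from the lower end to the upper one.\<close>

lemma cubic_lattice_edge_obtain:
  assumes "e \<in> cubic_lattice_edges"
  obtains x y z x' y' z' where "e = {(x, y, z), (x', y', z')}"
    "(x' = x + 1 \<and> y' = y \<and> z' = z) \<or> (x' = x \<and> y' = y + 1 \<and> z' = z) \<or> (x' = x \<and> y' = y \<and> z' = z + 1)"
proof -
  from assms obtain p q where "e = {p, q}" unfolding cubic_lattice_edges_def by auto
  moreover obtain x y z x' y' z' where "p = (x, y, z)" "q = (x', y', z')"
    by (metis prod_cases3)
  ultimately have e: "e = {(x, y, z), (x', y', z')}" by simp
  have sq: "(x - x')\<^sup>2 + (y - y')\<^sup>2 + (z - z')\<^sup>2 = 1"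
    using assms unfolding e cubic_lattice_edges_iff .
  have one: "a = 1 \<and> b = 0 \<and> c = 0 \<or> a = 0 \<and> b = 1 \<and> c = 0 \<or> a = 0 \<and> b = 0 \<and> c = 1"
    if "a \<ge> 0" "b \<ge> 0" "c \<ge> 0" "a + b + c = 1" for a b c :: int
    using that by smt
  have unit: "(a - b)\<^sup>2 = 1 \<longleftrightarrow> a = b + 1 \<or> b = a + 1" "(a - b)\<^sup>2 = 0 \<longleftrightarrow> b = a" for a b :: int
    by (auto simp: power2_eq_1_iff)
  have "((x' = x + 1 \<and> y' = y \<and> z' = z) \<or> (x' = x \<and> y' = y + 1 \<and> z' = z) \<or> (x' = x \<and> y' = y \<and> z' = z + 1))
    \<or> ((x = x' + 1 \<and> y = y' \<and> z = z') \<or> (x = x' \<and> y = y' + 1 \<and> z = z') \<or> (x = x' \<and> y = y' \<and> z = z' + 1))"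
    using one[OF zero_le_power2 zero_le_power2 zero_le_power2 sq] unfolding unit by blast
  then show thesis
  proof
    assume "(x' = x + 1 \<and> y' = y \<and> z' = z) \<or> (x' = x \<and> y' = y + 1 \<and> z' = z) \<or> (x' = x \<and> y' = y \<and> z' = z + 1)"
    then show thesis by (rule that[OF e])
  next
    assume "(x = x' + 1 \<and> y = y' \<and> z = z') \<or> (x = x' \<and> y = y' + 1 \<and> z = z') \<or> (x = x' \<and> y = y' \<and> z = z' + 1)"
    moreover have "e = {(x', y', z'), (x, y, z)}" using e by (simp add: insert_commute)
    ultimately show thesis by (rule that[rotated])
  qed
qed

definition coverings :: "(int \<times> int \<times> int) set \<Rightarrow> (int \<times> int \<times> int) set set set" where
  "coverings S = perfect_matchings S (induced_edges cubic_lattice_edges S)"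

lemma finite_induced_edges: "finite S \<Longrightarrow> finite (induced_edges E S)"
  by (rule finite_subset[of _ "Pow S"]) (auto simp: induced_edges_def)

lemma finite_coverings: "finite S \<Longrightarrow> finite (coverings S)"
  by (simp add: coverings_def perfect_matchings_eq_matchings finite_matchings finite_induced_edges)

text \<open>The two coverings can be read off from their union, since no edge is contained in both parts.\<close>

lemma card_coverings_Un:
  assumes fin: "finite S" "finite T" and disj: "S \<inter> T = {}"
  shows "card (coverings S) * card (coverings T) \<le> card (coverings (S \<union> T))"
proof -
  have sub: "M \<subseteq> induced_edges cubic_lattice_edges S" if "M \<in> coverings S" for M S
    using that by (auto simp: coverings_def perfect_matchings_def)
  have ex1: "\<exists>!e. e \<in> M \<and> v \<in> e" if "M \<in> coverings S" "v \<in> S" for M S v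
    using that unfolding coverings_def perfect_matchings_def by blast
  have in_S: "e \<subseteq> S" "e \<noteq> {}" if "M \<in> coverings S" "e \<in> M" for M S e
    using sub[OF that(1)] that(2) by (auto simp: induced_edges_def cubic_lattice_edges_def)
  have "card (coverings S \<times> coverings T) \<le> card (coverings (S \<union> T))"
  proof (rule card_inj_on_le[of "\<lambda>(M, N). M \<union> N"])
    show "finite (coverings (S \<union> T))" using fin by (simp add: finite_coverings)
    show "(\<lambda>(M, N). M \<union> N) ` (coverings S \<times> coverings T) \<subseteq> coverings (S \<union> T)"
    proof clarify
      fix M N assume M: "M \<in> coverings S" and N: "N \<in> coverings T"
      have "\<exists>!e. e \<in> M \<union> N \<and> v \<in> e" if v: "v \<in> S \<union> T" for v
      proof (cases "v \<in> S")
        case True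
        then have "e \<notin> N" if "v \<in> e" for e using in_S(1)[OF N] that disj by blast
        then show ?thesis using ex1[OF M True] by auto
      next
        case False
        then have "e \<notin> M" if "v \<in> e" for e using in_S(1)[OF M] that by blast
        then show ?thesis using ex1[OF N, of v] v False by auto
      qed
      moreover have "M \<union> N \<subseteq> induced_edges cubic_lattice_edges (S \<union> T)"
        using sub[OF M] sub[OF N] by (auto simp: induced_edges_def)
      ultimately show "M \<union> N \<in> coverings (S \<union> T)"
        by (auto simp: coverings_def perfect_matchings_def)
    qed
    have restrict: "M = {e \<in> M \<union> N. e \<subseteq> S}" "N = {e \<in> M \<union> N. e \<subseteq> T}"
      if M: "M \<in> coverings S" and N: "N \<in> coverings T" for M N
    proof -
      have "e \<notin> N" if "e \<subseteq> S" for e using in_S[OF N, of e] that disj by blast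
      then show "M = {e \<in> M \<union> N. e \<subseteq> S}" using in_S(1)[OF M] by blast
      have "e \<notin> M" if "e \<subseteq> T" for e using in_S[OF M, of e] that disj by blast
      then show "N = {e \<in> M \<union> N. e \<subseteq> T}" using in_S(1)[OF N] by blast
    qed
    show "inj_on (\<lambda>(M, N). M \<union> N) (coverings S \<times> coverings T)"
    proof (rule inj_onI, clarify)
      fix M N M' N'
      assume a: "M \<in> coverings S" "N \<in> coverings T" "M' \<in> coverings S" "N' \<in> coverings T"
        "M \<union> N = M' \<union> N'"
      show "M = M' \<and> N = N'"
        using restrict[OF a(1,2)] restrict[OF a(3,4)] unfolding a(5) by auto
    qed
  qed
  then show ?thesis by (simp add: card_cartesian_product)
qed

lemma card_coverings_translate:
  assumes "finite S"
  shows "card (coverings S) \<le> card (coverings ((\<lambda>p. p + t) ` S))"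
  unfolding coverings_def perfect_matchings_eq_matchings
proof (rule card_matchings_le_embedding[where f = "\<lambda>p. p + t" and h = "(`) (\<lambda>p. p + t)"])
  show "finite (induced_edges cubic_lattice_edges ((\<lambda>p. p + t) ` S))"
    using assms by (simp add: finite_induced_edges)
  have inj: "inj (\<lambda>p. p + t)" by (simp add: inj_on_def)
  then show "inj_on ((`) (\<lambda>p. p + t)) (induced_edges cubic_lattice_edges S)"
    by (metis inj_image_eq_iff inj_onI)
  show "(p + t \<in> (\<lambda>p. p + t) ` e) = (p \<in> e)" for p e
    using inj by (rule inj_image_mem_iff)
  show "(`) (\<lambda>p. p + t) ` induced_edges cubic_lattice_edges S
      \<subseteq> induced_edges cubic_lattice_edges ((\<lambda>p. p + t) ` S)"
  proof (rule image_subsetI)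
    fix e assume e: "e \<in> induced_edges cubic_lattice_edges S"
    then obtain x y z x' y' z' where xyz: "e = {(x, y, z), (x', y', z')}"
      by (auto simp: induced_edges_def elim: cubic_lattice_edge_obtain)
    obtain t1 t2 t3 where t: "t = (t1, t2, t3)" by (rule prod_cases3)
    have "(\<lambda>p. p + t) ` e \<in> cubic_lattice_edges"
      using e unfolding xyz induced_edges_def by (simp add: t cubic_lattice_edges_iff)
    then show "(\<lambda>p. p + t) ` e \<in> induced_edges cubic_lattice_edges ((\<lambda>p. p + t) ` S)"
      using e by (auto simp: induced_edges_def)
  qed
qed simp

lemma num_dimer_coverings_split:
  assumes box: "lattice_box a b c = lattice_box a1 b1 c1 \<union> (\<lambda>p. p + t) ` lattice_box a2 b2 c2"
    and disj: "lattice_box a1 b1 c1 \<inter> (\<lambda>p. p + t) ` lattice_box a2 b2 c2 = {}"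
  shows "num_dimer_coverings a1 b1 c1 * num_dimer_coverings a2 b2 c2 \<le> num_dimer_coverings a b c"
proof -
  have fin: "finite (lattice_box a b c)" for a b c by (simp add: lattice_box_def)
  have num: "num_dimer_coverings a b c = card (coverings (lattice_box a b c))" for a b c
    by (simp add: num_dimer_coverings_def coverings_def)
  have "card (coverings (lattice_box a1 b1 c1)) * card (coverings (lattice_box a2 b2 c2))
      \<le> card (coverings (lattice_box a1 b1 c1)) * card (coverings ((\<lambda>p. p + t) ` lattice_box a2 b2 c2))"
    by (intro mult_left_mono card_coverings_translate fin) simp
  also have "\<dots> \<le> card (coverings (lattice_box a b c))"
    unfolding box by (intro card_coverings_Un fin finite_imageI disj)
  finally show ?thesis unfolding num .
qed

lemma translated_box:
  "p \<in> (\<lambda>p. p + (t1, t2, t3)) ` lattice_box a b c \<longleftrightarrow> (case p of (x, y, z) \<Rightarrow>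
    t1 \<le> x \<and> x < t1 + int a \<and> t2 \<le> y \<and> y < t2 + int b \<and> t3 \<le> z \<and> z < t3 + int c)"
proof -
  obtain x y z where p: "p = (x, y, z)" by (rule prod_cases3)
  have "p \<in> (\<lambda>p. p + (t1, t2, t3)) ` lattice_box a b c \<longleftrightarrow> (x - t1, y - t2, z - t3) \<in> lattice_box a b c"
    unfolding p by (force simp: image_iff)
  then show ?thesis by (auto simp: p lattice_box_def)
qed

text \<open>Cutting a box by a plane perpendicular to one of the axes.\<close>

lemma num_dimer_coverings_add:
  "num_dimer_coverings a1 b c * num_dimer_coverings a2 b c \<le> num_dimer_coverings (a1 + a2) b c"
  "num_dimer_coverings a b1 c * num_dimer_coverings a b2 c \<le> num_dimer_coverings a (b1 + b2) c"
  "num_dimer_coverings a b c1 * num_dimer_coverings a b c2 \<le> num_dimer_coverings a b (c1 + c2)"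
proof -
  have mem: "(x, y, z) \<in> lattice_box a b c \<longleftrightarrow> 0 \<le> x \<and> x < int a \<and> 0 \<le> y \<and> y < int b \<and> 0 \<le> z \<and> z < int c"
    for x y z a b c by (auto simp: lattice_box_def)
  show "num_dimer_coverings a1 b c * num_dimer_coverings a2 b c \<le> num_dimer_coverings (a1 + a2) b c"
    by (rule num_dimer_coverings_split[where t = "(int a1, 0, 0)"])
      (auto simp: set_eq_iff translated_box mem)
  show "num_dimer_coverings a b1 c * num_dimer_coverings a b2 c \<le> num_dimer_coverings a (b1 + b2) c"
    by (rule num_dimer_coverings_split[where t = "(0, int b1, 0)"])
      (auto simp: set_eq_iff translated_box mem)
  show "num_dimer_coverings a b c1 * num_dimer_coverings a b c2 \<le> num_dimer_coverings a b (c1 + c2)"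
    by (rule num_dimer_coverings_split[where t = "(0, 0, int c1)"])
      (auto simp: set_eq_iff translated_box mem)
qed

lemma num_dimer_coverings_pos_if_covering:
  assumes "M \<in> coverings (lattice_box a b c)"
  shows "num_dimer_coverings a b c \<ge> 1"
proof -
  have "finite (coverings (lattice_box a b c))"
    by (intro finite_coverings) (simp add: lattice_box_def)
  then have "card (coverings (lattice_box a b c)) > 0" using assms card_gt_0_iff by blast
  then show ?thesis by (simp add: num_dimer_coverings_def coverings_def)
qed

text \<open>The empty box has the empty covering. Allowing empty boxes spares case distinctions when boxes
  are divided with remainder.\<close>

lemma num_dimer_coverings_empty_box:
  assumes "a = 0 \<or> b = 0 \<or> c = 0"
  shows "num_dimer_coverings a b c \<ge> 1"
proof (rule num_dimer_coverings_pos_if_covering)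
  have "lattice_box a b c = {}" using assms by (auto simp: lattice_box_def)
  then show "{} \<in> coverings (lattice_box a b c)"
    by (simp add: coverings_def perfect_matchings_def)
qed

lemma num_dimer_coverings_domino:
  "num_dimer_coverings 2 1 1 \<ge> 1" "num_dimer_coverings 1 2 1 \<ge> 1" "num_dimer_coverings 1 1 2 \<ge> 1"
proof -
  have two: "{0..<2} = {0, 1 :: int}" by auto
  have single: "num_dimer_coverings a b c \<ge> 1"
    if "lattice_box a b c = {p, q}" "{p, q} \<in> cubic_lattice_edges" for a b c p q
    by (rule num_dimer_coverings_pos_if_covering[of "{{p, q}}"])
      (use that in \<open>auto simp: coverings_def perfect_matchings_def induced_edges_def\<close>)
  show "num_dimer_coverings 2 1 1 \<ge> 1"
    by (rule single[of _ _ _ "(0, 0, 0)" "(1, 0, 0)"]) (auto simp: lattice_box_def cubic_lattice_edges_iff)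
  show "num_dimer_coverings 1 2 1 \<ge> 1"
    by (rule single[of _ _ _ "(0, 0, 0)" "(0, 1, 0)"]) (auto simp: lattice_box_def cubic_lattice_edges_iff)
  show "num_dimer_coverings 1 1 2 \<ge> 1"
    by (rule single[of _ _ _ "(0, 0, 0)" "(0, 0, 1)"]) (auto simp: lattice_box_def cubic_lattice_edges_iff)
qed

lemma num_dimer_coverings_power:
  "num_dimer_coverings p b c ^ i \<le> num_dimer_coverings (i * p) b c"
  "num_dimer_coverings a q c ^ i \<le> num_dimer_coverings a (i * q) c"
  "num_dimer_coverings a b r ^ i \<le> num_dimer_coverings a b (i * r)"
proof -
  show "num_dimer_coverings p b c ^ i \<le> num_dimer_coverings (i * p) b c"
  proof (induction i)
    case (Suc i)
    have "num_dimer_coverings p b c * num_dimer_coverings p b c ^ i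
        \<le> num_dimer_coverings p b c * num_dimer_coverings (i * p) b c"
      by (rule mult_left_mono[OF Suc]) simp
    from le_trans[OF this num_dimer_coverings_add(1)[of p b c "i * p"]] show ?case by simp
  qed (use num_dimer_coverings_empty_box[of 0 b c] in simp)
  show "num_dimer_coverings a q c ^ i \<le> num_dimer_coverings a (i * q) c"
  proof (induction i)
    case (Suc i)
    have "num_dimer_coverings a q c * num_dimer_coverings a q c ^ i
        \<le> num_dimer_coverings a q c * num_dimer_coverings a (i * q) c"
      by (rule mult_left_mono[OF Suc]) simp
    from le_trans[OF this num_dimer_coverings_add(2)[of a q c "i * q"]] show ?case by simp
  qed (use num_dimer_coverings_empty_box[of a 0 c] in simp)
  show "num_dimer_coverings a b r ^ i \<le> num_dimer_coverings a b (i * r)"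
  proof (induction i)
    case (Suc i)
    have "num_dimer_coverings a b r * num_dimer_coverings a b r ^ i
        \<le> num_dimer_coverings a b r * num_dimer_coverings a b (i * r)"
      by (rule mult_left_mono[OF Suc]) simp
    from le_trans[OF this num_dimer_coverings_add(3)[of a b r "i * r"]] show ?case by simp
  qed (use num_dimer_coverings_empty_box[of a b 0] in simp)
qed

lemma num_dimer_coverings_power3:
  "num_dimer_coverings p q r ^ (i * j * k) \<le> num_dimer_coverings (i * p) (j * q) (k * r)"
proof -
  have "num_dimer_coverings p q r ^ (i * j * k) = ((num_dimer_coverings p q r ^ i) ^ j) ^ k"
    by (simp add: power_mult)
  also have "\<dots> \<le> ((num_dimer_coverings (i * p) q r) ^ j) ^ k"
    by (intro power_mono num_dimer_coverings_power) auto
  also have "\<dots> \<le> (num_dimer_coverings (i * p) (j * q) r) ^ k"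
    by (intro power_mono num_dimer_coverings_power) auto
  also have "\<dots> \<le> num_dimer_coverings (i * p) (j * q) (k * r)"
    by (rule num_dimer_coverings_power)
  finally show ?thesis .
qed

lemma num_dimer_coverings_pos:
  assumes "even (a * b * c)"
  shows "num_dimer_coverings a b c \<ge> 1"
proof -
  have pos: "num_dimer_coverings (i * p) (j * q) (k * r) \<ge> 1"
    if "num_dimer_coverings p q r \<ge> 1" for p q r i j k
    using num_dimer_coverings_power3[of p q r i j k] one_le_power[OF that] by (meson le_trans)
  consider i where "a = i * 2" | j where "b = j * 2" | k where "c = k * 2"
    using assms by (auto elim!: evenE simp: mult.commute)
  then show ?thesis
  proof cases
    case 1 then show ?thesis using pos[OF num_dimer_coverings_domino(1), of i b c] by simp
  next
    case 2 then show ?thesis using pos[OF num_dimer_coverings_domino(2), of a j c] by simp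
  next
    case 3 then show ?thesis using pos[OF num_dimer_coverings_domino(3), of a b k] by simp
  qed
qed

text \<open>A box contains \<open>a div p\<close> times \<open>b div q\<close> times \<open>c div r\<close> copies of the smaller box. The rest is cut
  off by three planes into slabs. These have even volume, since the sides of the packed box are even
  and \<open>a mod p\<close> has the parity of \<open>a\<close>, and therefore can be covered.\<close>

lemma num_dimer_coverings_ge_power:
  assumes "even p" "even q" "even r" and abc: "even (a * b * c)"
  shows "num_dimer_coverings p q r ^ ((a div p) * (b div q) * (c div r)) \<le> num_dimer_coverings a b c"
proof -
  define a' b' c' where "a' = a div p * p" and "b' = b div q * q" and "c' = c div r * r"
  have ev: "even a'" "even b'" "even c'" using assms by (auto simp: a'_def b'_def c'_def)
  have a: "a = a' + a mod p" and b: "b = b' + b mod q" and c: "c = c' + c mod r"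
    by (simp_all add: a'_def b'_def c'_def)
  have par: "even (a mod p) \<longleftrightarrow> even a" using assms(1) by (simp add: dvd_mod_iff)
  have "num_dimer_coverings p q r ^ ((a div p) * (b div q) * (c div r)) \<le> num_dimer_coverings a' b' c' * 1"
    unfolding a'_def b'_def c'_def by (simp add: num_dimer_coverings_power3)
  also have "\<dots> \<le> num_dimer_coverings a' b' c' * num_dimer_coverings a' b' (c mod r)"
    by (intro mult_left_mono num_dimer_coverings_pos) (use ev in auto)
  also have "\<dots> \<le> num_dimer_coverings a' b' c * 1"
    using num_dimer_coverings_add(3)[of a' b' c' "c mod r"] c by simp
  also have "\<dots> \<le> num_dimer_coverings a' b' c * num_dimer_coverings a' (b mod q) c"
    by (intro mult_left_mono num_dimer_coverings_pos) (use ev in auto)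
  also have "\<dots> \<le> num_dimer_coverings a' b c * 1"
    using num_dimer_coverings_add(2)[of a' b' c "b mod q"] b by simp
  also have "\<dots> \<le> num_dimer_coverings a' b c * num_dimer_coverings (a mod p) b c"
    by (intro mult_left_mono num_dimer_coverings_pos) (use abc par in auto)
  also have "\<dots> \<le> num_dimer_coverings a b c"
    using num_dimer_coverings_add(1)[of a' b c "a mod p"] a by simp
  finally show ?thesis .
qed

section \<open>Cyclic stacks of layers and their double covers\<close>

text \<open>The upward edges between the projections of two consecutive levels.\<close>

definition step_rel :: "nat \<Rightarrow> nat \<Rightarrow> ((int \<times> int) \<times> (int \<times> int)) set" where
  "step_rel m n = {(u, w). u \<in> torus m n \<and> w \<in> torus m n \<and> torus_matrix m n u w = 1}"

text \<open>The edge \<open>((u, w), k)\<close> joins vertex \<open>u\<close> of level \<open>k\<close> to vertex \<open>w\<close> of the cyclically next level. For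
  \<open>L = 2\<close> there are edges in both directions between the two levels, and they are kept apart by \<open>k\<close>.\<close>

definition layer_inc :: "nat \<Rightarrow> 'v \<times> nat \<Rightarrow> ('v \<times> 'v) \<times> nat \<Rightarrow> bool" where
  "layer_inc L = (\<lambda>(v, j) ((u, w), k). v = u \<and> j = k \<or> v = w \<and> j = Suc k mod L)"

definition cyclic_matchings :: "'v set \<Rightarrow> ('v \<times> 'v) set \<Rightarrow> nat \<Rightarrow> (('v \<times> 'v) \<times> nat) set set" where
  "cyclic_matchings V R L = matchings (V \<times> {..<L}) (R \<times> {..<L}) (layer_inc L)"

lemma Suc_mod_cases:
  assumes "k < L" "even L" "(j::nat) = Suc k mod L"
  shows "j < L" "even j \<longleftrightarrow> odd k" "j \<noteq> k"
proof -
  show "j < L" using assms by simp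
  show 2: "even j \<longleftrightarrow> odd k" using assms by (simp add: dvd_mod_iff)
  then show "j \<noteq> k" by auto
qed

text \<open>A double cover of the layers, with projection \<open>\<pi>\<close> and sheets \<open>\<sigma>\<close>, makes the stacks of layers a double
  cover. For even \<open>L\<close> the base is bipartite, the classes being the even and the odd levels. The copy of an
  edge is the sheet of its lower end, so that only the upper end has a voltage.\<close>

lemma card_cyclic_matchings_double_cover_le:
  fixes V :: "'v set" and V' :: "'w set"
  assumes fin: "finite R" and R: "R \<subseteq> V \<times> V" and L: "even L"
    and inj: "inj_on (\<lambda>v. (\<pi> v, \<sigma> v)) V'" and onto: "V \<times> UNIV \<subseteq> (\<lambda>v. (\<pi> v, \<sigma> v)) ` V'"
    and R': "R' \<subseteq> V' \<times> V'"
    and proj: "\<And>p q. (p, q) \<in> R' \<Longrightarrow> (\<pi> p, \<pi> q) \<in> R \<and> \<sigma> q = (\<sigma> p \<noteq> \<epsilon> (\<pi> p) (\<pi> q))"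
  shows "card (cyclic_matchings V' R' L) \<le> (card (cyclic_matchings V R L))\<^sup>2"
proof -
  define g where "g = (\<lambda>(v :: 'v, j :: nat) ((u, w), k). j \<noteq> k \<and> \<epsilon> u w)"
  define f where "f = (\<lambda>(v, j :: nat). ((\<pi> v, j), \<sigma> v))"
  define h where "h = (\<lambda>((p, q), k :: nat). (((\<pi> p, \<pi> q), k), \<sigma> p))"
  define B W where "B = V \<times> {j. j < L \<and> even j}" and "W = V \<times> {j. j < L \<and> odd j}"
  have BW: "V \<times> {..<L} = B \<union> W" by (auto simp: B_def W_def)
  have "card (cyclic_matchings V' R' L)
      \<le> card (matchings ((B \<union> W) \<times> UNIV) ((R \<times> {..<L}) \<times> UNIV) (lift_inc (layer_inc L) g))"
    unfolding cyclic_matchings_def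
  proof (rule card_matchings_le_embedding[where f = f and h = h])
    show "finite ((R \<times> {..<L}) \<times> (UNIV :: bool set))" using fin by simp
    show "h ` (R' \<times> {..<L}) \<subseteq> (R \<times> {..<L}) \<times> UNIV"
      using proj by (auto simp: h_def)
    show "inj_on h (R' \<times> {..<L})"
    proof (rule inj_onI, clarsimp simp: h_def)
      fix p q p' q' assume a: "(p, q) \<in> R'" "(p', q') \<in> R'" "\<pi> p = \<pi> p'" "\<pi> q = \<pi> q'" "\<sigma> p = \<sigma> p'"
      have "\<sigma> q = \<sigma> q'" using proj[OF a(1)] proj[OF a(2)] a by simp
      then show "p = p' \<and> q = q'" using a inj R' unfolding inj_on_def by blast
    qed
    show "(B \<union> W) \<times> UNIV \<subseteq> f ` (V' \<times> {..<L})"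
    proof clarify
      fix v j s assume "(v, j) \<in> B \<union> W"
      then have v: "v \<in> V" "j < L" by (auto simp: B_def W_def)
      then obtain v' where "v' \<in> V'" "v = \<pi> v'" "s = \<sigma> v'" using onto by blast
      then show "((v, j), s) \<in> f ` (V' \<times> {..<L})"
        using v by (force simp: f_def)
    qed
    fix vj e assume vj: "vj \<in> V' \<times> {..<L}" and e: "e \<in> R' \<times> {..<L}"
    obtain v j p q k where eq: "vj = (v, j)" "e = ((p, q), k)" by (metis prod.exhaust)
    have mem: "v \<in> V'" "(p, q) \<in> R'" "k < L" "p \<in> V'" "q \<in> V'" using vj e eq R' by auto
    have same: "v = w \<longleftrightarrow> \<pi> v = \<pi> w \<and> \<sigma> v = \<sigma> w" if "w \<in> V'" for w
      using inj mem(1) that unfolding inj_on_def by blast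
    have kL: "Suc k mod L \<noteq> k" using Suc_mod_cases(3)[OF mem(3) L refl] .
    show "lift_inc (layer_inc L) g (f vj) (h e) \<longleftrightarrow> layer_inc L vj e"
      using same[OF mem(4)] same[OF mem(5)] proj[OF mem(2)] kL
      by (auto simp: eq f_def h_def lift_inc_def layer_inc_def g_def)
  qed
  also have "\<dots> \<le> (card (matchings (B \<union> W) (R \<times> {..<L}) (layer_inc L)))\<^sup>2"
  proof (rule card_matchings_double_cover_le)
    show "finite (R \<times> {..<L})" using fin by simp
    fix e assume e: "e \<in> R \<times> {..<L}"
    then obtain u w k where eq: "e = ((u, w), k)" and mem: "u \<in> V" "w \<in> V" "k < L"
      using R by auto
    define k' where "k' = Suc k mod L"
    note k' = Suc_mod_cases[OF mem(3) L k'_def]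
    show "\<exists>!v. v \<in> B \<and> layer_inc L v e"
      by (rule ex1I[of _ "if even k then (u, k) else (w, k')"])
        (use mem k' in \<open>auto simp: eq layer_inc_def B_def k'_def[symmetric] split: if_splits\<close>)
    show "\<exists>!v. v \<in> W \<and> layer_inc L v e"
      by (rule ex1I[of _ "if odd k then (u, k) else (w, k')"])
        (use mem k' in \<open>auto simp: eq layer_inc_def W_def k'_def[symmetric] split: if_splits\<close>)
  qed
  finally show ?thesis unfolding cyclic_matchings_def BW .
qed

lemma diff_mod_eq_0_1:
  assumes "0 \<le> x" "x < int m" "0 \<le> x'" "x' < int m" "m \<ge> 2"
  shows "(x' - x) mod int m = 0 \<longleftrightarrow> x' = x"
    "(x' - x) mod int m = 1 \<longleftrightarrow> x' = (if x + 1 = int m then 0 else x + 1)"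
proof -
  have *: "(x' - x) mod int m = (if x \<le> x' then x' - x else x' - x + int m)"
  proof (cases "x \<le> x'")
    case False
    have "(x' - x) mod int m = (x' - x + int m) mod int m" by simp
    also have "\<dots> = x' - x + int m" using assms False by (intro mod_pos_pos_trivial) auto
    finally show ?thesis using False by simp
  qed (use assms in \<open>simp add: mod_pos_pos_trivial\<close>)
  show "(x' - x) mod int m = 0 \<longleftrightarrow> x' = x" unfolding * using assms by auto
  show "(x' - x) mod int m = 1 \<longleftrightarrow> x' = (if x + 1 = int m then 0 else x + 1)"
    unfolding * using assms by auto
qed

text \<open>Sides of length at least two keep the three upward edges at a vertex distinct.\<close>

lemma step_rel_iff:
  assumes "m \<ge> 2" "n \<ge> 2"
  shows "((x, y), (x', y')) \<in> step_rel m n \<longleftrightarrow>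
    0 \<le> x \<and> x < int m \<and> 0 \<le> y \<and> y < int n \<and>
    (x' = x \<and> y' = y \<or> x' = (if x + 1 = int m then 0 else x + 1) \<and> y' = y
      \<or> x' = x \<and> y' = (if y + 1 = int n then 0 else y + 1))"
    (is "?l \<longleftrightarrow> ?r")
proof
  assume l: ?l
  then have "0 \<le> x" "x < int m" "0 \<le> x'" "x' < int m" "0 \<le> y" "y < int n" "0 \<le> y'" "y' < int n"
    by (auto simp: step_rel_def torus_def)
  note this diff_mod_eq_0_1[OF this(1-4) assms(1)] diff_mod_eq_0_1[OF this(5-8) assms(2)]
  then show ?r using l by (auto simp: step_rel_def torus_matrix_def torus_diff_def split: if_splits)
next
  assume r: ?r
  then have "0 \<le> x" "x < int m" "0 \<le> x'" "x' < int m" "0 \<le> y" "y < int n" "0 \<le> y'" "y' < int n"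
    using assms by (auto split: if_splits)
  note this diff_mod_eq_0_1[OF this(1-4) assms(1)] diff_mod_eq_0_1[OF this(5-8) assms(2)]
  then show ?l using r by (simp add: step_rel_def torus_def torus_matrix_def torus_diff_def)
qed

lemma finite_step_rel: "finite (step_rel m n)"
  by (rule finite_subset[of _ "torus m n \<times> torus m n"]) (auto simp: step_rel_def torus_def)

definition torus_count :: "nat \<Rightarrow> nat \<Rightarrow> nat \<Rightarrow> nat" where
  "torus_count m n L = card (cyclic_matchings (torus m n) (step_rel m n) L)"

text \<open>The sheet tells in which half of the doubled side a vertex lies. It changes along an edge exactly
  when the reduced coordinate wraps around, that is, when it decreases.\<close>

lemma torus_count_double:
  assumes mn: "m \<ge> 2" "n \<ge> 2" and L: "even L"
  shows "torus_count (2 * m) n L \<le> (torus_count m n L)\<^sup>2"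
    and "torus_count m (2 * n) L \<le> (torus_count m n L)\<^sup>2"
proof -
  have mn': "2 * m \<ge> 2" "2 * n \<ge> 2" using mn by auto
  show "torus_count (2 * m) n L \<le> (torus_count m n L)\<^sup>2"
    unfolding torus_count_def
  proof (rule card_cyclic_matchings_double_cover_le[where \<pi> = "\<lambda>(x, y). (if int m \<le> x then x - int m else x, y)"
        and \<sigma> = "\<lambda>(x, y). int m \<le> x" and \<epsilon> = "\<lambda>u w. fst w < fst u"])
    show "torus m n \<times> UNIV \<subseteq> (\<lambda>v. (case v of (x, y) \<Rightarrow> (if int m \<le> x then x - int m else x, y),
        case v of (x, y) \<Rightarrow> int m \<le> x)) ` torus (2 * m) n"
    proof clarify
      fix x y s assume "(x, y) \<in> torus m n"
      then show "((x, y), s) \<in> (\<lambda>v. (case v of (x, y) \<Rightarrow> (if int m \<le> x then x - int m else x, y),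
        case v of (x, y) \<Rightarrow> int m \<le> x)) ` torus (2 * m) n"
        by (intro image_eqI[of _ _ "(if s then x + int m else x, y)"]) (auto simp: torus_def)
    qed
    show "(case p of (x, y) \<Rightarrow> (if int m \<le> x then x - int m else x, y),
         case q of (x, y) \<Rightarrow> (if int m \<le> x then x - int m else x, y)) \<in> step_rel m n \<and>
        (case q of (x, y) \<Rightarrow> int m \<le> x) = ((case p of (x, y) \<Rightarrow> int m \<le> x) \<noteq>
         (fst (case q of (x, y) \<Rightarrow> (if int m \<le> x then x - int m else x, y))
          < fst (case p of (x, y) \<Rightarrow> (if int m \<le> x then x - int m else x, y))))"
      if "(p, q) \<in> step_rel (2 * m) n" for p q
    proof -
      obtain x y x' y' where pq: "p = (x, y)" "q = (x', y')" by fastforce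
      show ?thesis using that mn unfolding pq prod.case step_rel_iff[OF mn'(1) mn(2)] step_rel_iff[OF mn] fst_conv
        by (auto split: if_splits)
    qed
  qed (use finite_step_rel L in \<open>auto simp: step_rel_def inj_on_def torus_def split: if_splits\<close>)
  show "torus_count m (2 * n) L \<le> (torus_count m n L)\<^sup>2"
    unfolding torus_count_def
  proof (rule card_cyclic_matchings_double_cover_le[where \<pi> = "\<lambda>(x, y). (x, if int n \<le> y then y - int n else y)"
        and \<sigma> = "\<lambda>(x, y). int n \<le> y" and \<epsilon> = "\<lambda>u w. snd w < snd u"])
    show "torus m n \<times> UNIV \<subseteq> (\<lambda>v. (case v of (x, y) \<Rightarrow> (x, if int n \<le> y then y - int n else y),
        case v of (x, y) \<Rightarrow> int n \<le> y)) ` torus m (2 * n)"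
    proof clarify
      fix x y s assume "(x, y) \<in> torus m n"
      then show "((x, y), s) \<in> (\<lambda>v. (case v of (x, y) \<Rightarrow> (x, if int n \<le> y then y - int n else y),
        case v of (x, y) \<Rightarrow> int n \<le> y)) ` torus m (2 * n)"
        by (intro image_eqI[of _ _ "(x, if s then y + int n else y)"]) (auto simp: torus_def)
    qed
    show "(case p of (x, y) \<Rightarrow> (x, if int n \<le> y then y - int n else y),
         case q of (x, y) \<Rightarrow> (x, if int n \<le> y then y - int n else y)) \<in> step_rel m n \<and>
        (case q of (x, y) \<Rightarrow> int n \<le> y) = ((case p of (x, y) \<Rightarrow> int n \<le> y) \<noteq>
         (snd (case q of (x, y) \<Rightarrow> (x, if int n \<le> y then y - int n else y))
          < snd (case p of (x, y) \<Rightarrow> (x, if int n \<le> y then y - int n else y))))"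
      if "(p, q) \<in> step_rel m (2 * n)" for p q
    proof -
      obtain x y x' y' where pq: "p = (x, y)" "q = (x', y')" by fastforce
      show ?thesis using that mn unfolding pq prod.case step_rel_iff[OF mn(1) mn'(2)] step_rel_iff[OF mn] snd_conv
        by (auto split: if_splits)
    qed
  qed (use finite_step_rel L in \<open>auto simp: step_rel_def inj_on_def torus_def split: if_splits\<close>)
qed

section \<open>A box embeds into a twisted torus\<close>

text \<open>The vertex \<open>(x, y, z)\<close> goes to the point \<open>(x, y)\<close> of level \<open>x + y + z\<close>. This is a bijection from the box
  to the vertices of the torus: for given \<open>x\<close> and \<open>y\<close> the coordinate \<open>z\<close> runs through all residues
  modulo \<open>L\<close>.\<close>

lemma num_dimer_coverings_le_torus_count:
  assumes mn: "m \<ge> 2" "n \<ge> 2" and L: "L \<ge> 2"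
  shows "num_dimer_coverings m n L \<le> torus_count m n L"
proof -
  define lev :: "int \<times> int \<times> int \<Rightarrow> int" where "lev = (\<lambda>(x, y, z). x + y + z)"
  define xy :: "int \<times> int \<times> int \<Rightarrow> int \<times> int" where "xy = (\<lambda>(x, y, z). (x, y))"
  define lower where "lower e = (THE p. p \<in> e \<and> (\<forall>q\<in>e. lev p \<le> lev q))" for e
  define upper where "upper e = (THE p. p \<in> e \<and> (\<forall>q\<in>e. lev q \<le> lev p))" for e
  define f where "f p = (xy p, nat (lev p mod int L))" for p
  define h where "h e = ((xy (lower e), xy (upper e)), nat (lev (lower e) mod int L))" for e
  let ?box = "lattice_box m n L"
  let ?E = "induced_edges cubic_lattice_edges ?box"
  have edge: "\<exists>p q. e = {p, q} \<and> lower e = p \<and> upper e = q \<and> p \<in> ?box \<and> q \<in> ?box \<and> p \<noteq> q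
      \<and> lev q = lev p + 1 \<and> (xy p, xy q) \<in> step_rel m n" if e: "e \<in> ?E" for e
  proof -
    have "e \<in> cubic_lattice_edges" "e \<subseteq> ?box" using e by (auto simp: induced_edges_def)
    then obtain x y z x' y' z' where xyz: "e = {(x, y, z), (x', y', z')}"
      "(x' = x + 1 \<and> y' = y \<and> z' = z) \<or> (x' = x \<and> y' = y + 1 \<and> z' = z) \<or> (x' = x \<and> y' = y \<and> z' = z + 1)"
      by (elim cubic_lattice_edge_obtain)
    define p q where "p = (x, y, z)" and "q = (x', y', z')"
    have pq: "e = {p, q}" "p \<in> ?box" "q \<in> ?box" using xyz \<open>e \<subseteq> ?box\<close> by (auto simp: p_def q_def)
    have lev: "lev q = lev p + 1" using xyz(2) by (auto simp: p_def q_def lev_def)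
    have "lower e = p" unfolding lower_def
      by (rule the_equality) (use pq lev in auto)
    moreover have "upper e = q" unfolding upper_def
      by (rule the_equality) (use pq lev in auto)
    moreover have "(xy p, xy q) \<in> step_rel m n"
      using pq(2,3) xyz(2) unfolding xy_def p_def q_def prod.case step_rel_iff[OF mn]
      by (auto simp: lattice_box_def)
    ultimately show ?thesis using pq lev by (intro exI[of _ p] exI[of _ q]) auto
  qed
  \<comment> \<open>Only the residue of the level is known, but that determines \<open>z\<close> once \<open>x\<close> and \<open>y\<close> are known.\<close>
  have f_inj: "p = q" if "p \<in> ?box" "q \<in> ?box" "f p = f q" for p q
  proof -
    obtain x y z x' y' z' where pq: "p = (x, y, z)" "q = (x', y', z')" by (metis prod_cases3)
    have xy: "x = x'" "y = y'" using that(3) by (auto simp: f_def xy_def pq)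
    have "(x + y + z) mod int L = (x + y + z') mod int L"
      using that(3) L by (simp add: f_def lev_def pq xy eq_nat_nat_iff)
    then have "z mod int L = z' mod int L"
      by (metis add_diff_cancel_left' mod_diff_left_eq)
    then have "z = z'" using that(1,2) by (simp add: pq lattice_box_def mod_pos_pos_trivial)
    then show ?thesis using xy pq by simp
  qed
  have succ: "nat ((lev p + 1) mod int L) = Suc (nat (lev p mod int L)) mod L" for p
  proof -
    have "(lev p + 1) mod int L = (lev p mod int L + 1) mod int L" by (simp add: mod_add_left_eq)
    also have "\<dots> = int (Suc (nat (lev p mod int L)) mod L)"
      using L by (simp add: zmod_int add.commute)
    finally show ?thesis by simp
  qed
  have "card (coverings ?box) \<le> card (cyclic_matchings (torus m n) (step_rel m n) L)"
    unfolding coverings_def perfect_matchings_eq_matchings cyclic_matchings_def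
  proof (rule card_matchings_le_embedding[where f = f and h = h])
    show "finite (step_rel m n \<times> {..<L})" by (simp add: finite_step_rel)
    show "h ` ?E \<subseteq> step_rel m n \<times> {..<L}"
    proof (rule image_subsetI)
      fix e assume "e \<in> ?E"
      from edge[OF this] show "h e \<in> step_rel m n \<times> {..<L}"
        using L by (auto simp: h_def nat_less_iff)
    qed
    show "inj_on h ?E"
    proof (rule inj_onI)
      fix e e' assume e: "e \<in> ?E" and e': "e' \<in> ?E" and eq: "h e = h e'"
      obtain p q where pq: "e = {p, q}" "lower e = p" "upper e = q" "p \<in> ?box" "q \<in> ?box"
        "lev q = lev p + 1" using edge[OF e] by blast
      obtain p' q' where pq': "e' = {p', q'}" "lower e' = p'" "upper e' = q'" "p' \<in> ?box" "q' \<in> ?box"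
        "lev q' = lev p' + 1" using edge[OF e'] by blast
      have "f p = f p'" using eq by (simp add: h_def f_def pq(2,3) pq'(2,3))
      moreover have "f q = f q'"
        using eq succ[of p] succ[of p'] by (simp add: h_def f_def pq(2,3,6) pq'(2,3,6))
      ultimately have "p = p'" "q = q'" using f_inj pq(4,5) pq'(4,5) by blast+
      then show "e = e'" using pq(1) pq'(1) by simp
    qed
    show "torus m n \<times> {..<L} \<subseteq> f ` ?box"
    proof clarify
      fix x y k assume xy: "(x, y) \<in> torus m n" and k: "k < L"
      define z where "z = (int k - x - y) mod int L"
      have z: "0 \<le> z" "z < int L" using L by (auto simp: z_def)
      have "(x + y + z) mod int L = int k"
        using k by (simp add: z_def mod_add_right_eq mod_pos_pos_trivial)
      then have "((x, y), k) = f (x, y, z)" by (simp add: f_def xy_def lev_def)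
      moreover have "(x, y, z) \<in> ?box" using xy z by (auto simp: torus_def lattice_box_def)
      ultimately show "((x, y), k) \<in> f ` ?box" by (rule image_eqI)
    qed
    fix v e assume v: "v \<in> ?box" and e: "e \<in> ?E"
    obtain p q where pq: "e = {p, q}" "lower e = p" "upper e = q" "p \<in> ?box" "q \<in> ?box"
      "lev q = lev p + 1" using edge[OF e] by blast
    have "layer_inc L (f v) (h e) \<longleftrightarrow> f v = f p \<or> f v = f q"
      using succ[of p] by (simp add: layer_inc_def f_def h_def pq(2,3,6))
    also have "\<dots> \<longleftrightarrow> v \<in> e" using f_inj[OF v pq(4)] f_inj[OF v pq(5)] pq(1) by auto
    finally show "layer_inc L (f v) (h e) \<longleftrightarrow> v \<in> e" .
  qed
  then show ?thesis by (simp add: num_dimer_coverings_def coverings_def torus_count_def)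
qed

section \<open>Counting by the transfer matrix\<close>

text \<open>The edges between two consecutive levels, when \<open>U\<close> is the set of vertices of the lower level that
  are matched upwards and \<open>W\<close> the corresponding set of the upper level, whose other vertices are
  matched downwards.\<close>

definition step_matchings :: "'v set \<Rightarrow> ('v \<times> 'v) set \<Rightarrow> 'v set \<Rightarrow> 'v set \<Rightarrow> ('v \<times> 'v) set set" where
  "step_matchings V R U W = {X. X \<subseteq> R \<and> bij_betw fst X U \<and> bij_betw snd X (V - W)}"

text \<open>A set of edges in \<open>step_matchings\<close> is the graph of a bijection, and every such bijection
  contributes one to the permanent. A nonempty set of matchings forces the condition on the
  cardinalities under which the entry is not set to zero.\<close>

lemma card_step_matchings_le_transfer_entry:
  assumes U: "U \<subseteq> torus m n" and W: "W \<subseteq> torus m n"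
  shows "card (step_matchings (torus m n) (step_rel m n) U W) \<le> transfer_entry m n U W"
proof (cases "step_matchings (torus m n) (step_rel m n) U W = {}")
  case False
  let ?S = "step_matchings (torus m n) (step_rel m n) U W" and ?C = "torus m n - W"
  let ?P = "{\<sigma> \<in> U \<rightarrow>\<^sub>E ?C. bij_betw \<sigma> U ?C}"
  have fin: "finite (torus m n)" by (simp add: torus_def)
  have finU: "finite U" and finW: "finite W" using finite_subset[OF _ fin] U W by auto
  obtain X where X: "bij_betw fst X U" "bij_betw snd X ?C"
    using False by (auto simp: step_matchings_def)
  have "card U = card ?C" using bij_betw_same_card[OF X(1)] bij_betw_same_card[OF X(2)] by simp
  also have "\<dots> = card (torus m n) - card W" using finW W by (rule card_Diff_subset)
  finally have card: "card U + card W = m * n"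
    using card_mono[OF fin W] by (simp add: torus_def card_cartesian_product)
  define \<sigma> where "\<sigma> X = restrict (\<lambda>u. snd (the_inv_into X fst u)) U" for X :: "((int \<times> int) \<times> (int \<times> int)) set"
  have graph: "X = (\<lambda>u. (u, \<sigma> X u)) ` U" and \<sigma>: "\<sigma> X \<in> ?P" "\<And>u. u \<in> U \<Longrightarrow> (u, \<sigma> X u) \<in> step_rel m n"
    if "X \<in> ?S" for X
  proof -
    have X: "X \<subseteq> step_rel m n" "bij_betw fst X U" "bij_betw snd X ?C"
      using that by (auto simp: step_matchings_def)
    have inj: "inj_on fst X" and im: "fst ` X = U" using X(2) by (auto simp: bij_betw_def)
    have val: "\<sigma> X (fst e) = snd e" if "e \<in> X" for e
      using that im by (auto simp: \<sigma>_def the_inv_into_f_f[OF inj that] restrict_def)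
    have *: "(\<lambda>u. (u, \<sigma> X u)) (fst e) = e" if "e \<in> X" for e
      using val[OF that] by simp
    show gr: "X = (\<lambda>u. (u, \<sigma> X u)) ` U"
      unfolding im[symmetric] image_image using * by simp
    show "(u, \<sigma> X u) \<in> step_rel m n" if "u \<in> U" for u
      using X(1) gr that by blast
    have "bij_betw (the_inv_into X fst) U X" by (rule bij_betw_the_inv_into[OF X(2)])
    from bij_betw_trans[OF this X(3)] have "bij_betw (\<sigma> X) U ?C"
      by (rule iffD1[OF bij_betw_cong, rotated]) (simp add: \<sigma>_def)
    then show "\<sigma> X \<in> ?P" by (auto simp: \<sigma>_def bij_betw_def)
  qed
  have finP: "finite ?P"
    by (rule finite_subset[OF _ finite_PiE[of U "\<lambda>_. ?C"]]) (use fin finU in auto)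
  have "card ?S = card (\<sigma> ` ?S)"
  proof (rule card_image[symmetric], rule inj_onI)
    fix X Y assume XY: "X \<in> ?S" "Y \<in> ?S" "\<sigma> X = \<sigma> Y"
    have "X = (\<lambda>u. (u, \<sigma> Y u)) ` U" by (rule graph[OF XY(1), unfolded XY(3)])
    also have "\<dots> = Y" by (rule graph[OF XY(2), symmetric])
    finally show "X = Y" .
  qed
  also have "\<dots> = (\<Sum>s \<in> \<sigma> ` ?S. 1)" by simp
  also have "\<dots> = (\<Sum>s \<in> \<sigma> ` ?S. \<Prod>u\<in>U. torus_matrix m n u (s u))"
  proof (intro sum.cong refl)
    fix s assume "s \<in> \<sigma> ` ?S"
    then obtain X where X: "X \<in> ?S" "s = \<sigma> X" by blast
    have "torus_matrix m n u (s u) = 1" if "u \<in> U" for u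
      using \<sigma>(2)[OF X(1) that] unfolding X(2) by (simp add: step_rel_def)
    then show "1 = (\<Prod>u\<in>U. torus_matrix m n u (s u))" by simp
  qed
  also have "\<dots> \<le> (\<Sum>s \<in> ?P. \<Prod>u\<in>U. torus_matrix m n u (s u))"
    by (rule sum_mono2[OF finP]) (use \<sigma>(1) in auto)
  finally show ?thesis using card by (simp add: transfer_entry_def permanent_def)
qed simp

definition layer :: "(('v \<times> 'v) \<times> nat) set \<Rightarrow> nat \<Rightarrow> ('v \<times> 'v) set" where
  "layer M k = {r. (r, k) \<in> M}"

text \<open>Matchings of an open stack of \<open>l\<close> steps, with the witness \<open>S k\<close> for the set of vertices of level \<open>k\<close>
  that are matched upwards. On the boundary, \<open>U\<close> and \<open>W\<close> are prescribed.\<close>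

definition walks :: "'v set \<Rightarrow> ('v \<times> 'v) set \<Rightarrow> nat \<Rightarrow> 'v set \<Rightarrow> 'v set \<Rightarrow> (('v \<times> 'v) \<times> nat) set set" where
  "walks V R l U W = {M. M \<subseteq> R \<times> {..<l} \<and> (\<exists>S. S 0 = U \<and> S l = W \<and> (\<forall>k\<le>l. S k \<subseteq> V) \<and>
     (\<forall>k<l. layer M k \<in> step_matchings V R (S k) (S (Suc k))))}"

lemma finite_walks: "finite R \<Longrightarrow> finite (walks V R l U W)"
  by (rule finite_subset[of _ "Pow (R \<times> {..<l})"]) (auto simp: walks_def)

text \<open>Powers of a matrix indexed by a set, which postpone the enumeration of the index set.\<close>

fun kernel_power :: "'i set \<Rightarrow> ('i \<Rightarrow> 'i \<Rightarrow> nat) \<Rightarrow> nat \<Rightarrow> 'i \<Rightarrow> 'i \<Rightarrow> nat" where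
  "kernel_power I K 0 U W = (if U = W then 1 else 0)"
| "kernel_power I K (Suc l) U W = (\<Sum>S\<in>I. kernel_power I K l U S * K S W)"

text \<open>Splitting off the last step.\<close>

lemma card_walks_le_kernel_power:
  assumes fin: "finite V" "finite R" and W: "W \<subseteq> V"
    and K: "\<And>U W. U \<subseteq> V \<Longrightarrow> W \<subseteq> V \<Longrightarrow> card (step_matchings V R U W) \<le> K U W"
  shows "card (walks V R l U W) \<le> kernel_power (Pow V) K l U W"
  using W
proof (induction l arbitrary: W)
  case 0
  have "walks V R 0 U W \<subseteq> (if U = W then {{}} else {})" by (auto simp: walks_def)
  then have "card (walks V R 0 U W) \<le> card (if U = W then {{} :: (('a \<times> 'a) \<times> nat) set} else {})"
    by (rule card_mono[rotated]) simp
  then show ?case by (cases "U = W") simp_all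
next
  case (Suc l)
  let ?pairs = "\<Union>S\<in>Pow V. walks V R l U S \<times> step_matchings V R S W"
  let ?f = "\<lambda>M. (M \<inter> R \<times> {..<l}, layer M l)"
  have finS: "finite (step_matchings V R S W)" for S
    by (rule finite_subset[of _ "Pow R"]) (use fin in \<open>auto simp: step_matchings_def\<close>)
  have "card (walks V R (Suc l) U W) \<le> card ?pairs"
  proof (rule card_inj_on_le[of ?f])
    show "inj_on ?f (walks V R (Suc l) U W)"
    proof (rule inj_onI)
      fix M N assume MN: "M \<in> walks V R (Suc l) U W" "N \<in> walks V R (Suc l) U W" "?f M = ?f N"
      have split: "M = (M \<inter> R \<times> {..<l}) \<union> (layer M l \<times> {l})" if "M \<in> walks V R (Suc l) U W" for M
        using that by (auto simp: walks_def layer_def less_Suc_eq)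
      show "M = N" using split[OF MN(1)] split[OF MN(2)] MN(3) by simp
    qed
    show "?f ` walks V R (Suc l) U W \<subseteq> ?pairs"
    proof (rule image_subsetI)
      fix M assume "M \<in> walks V R (Suc l) U W"
      then obtain S where M: "M \<subseteq> R \<times> {..<Suc l}" and S: "S 0 = U" "S (Suc l) = W" "\<forall>k\<le>Suc l. S k \<subseteq> V"
        "\<forall>k<Suc l. layer M k \<in> step_matchings V R (S k) (S (Suc k))"
        by (auto simp: walks_def)
      have "layer (M \<inter> R \<times> {..<l}) k = layer M k" if "k < l" for k
        using that M by (auto simp: layer_def)
      then have "M \<inter> R \<times> {..<l} \<in> walks V R l U (S l)"
        unfolding walks_def using S by (intro CollectI conjI exI[of _ S]) auto
      moreover have "layer M l \<in> step_matchings V R (S l) W" using S by auto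
      moreover have "S l \<in> Pow V" using S(3) by simp
      ultimately show "?f M \<in> ?pairs" by blast
    qed
    show "finite ?pairs" using fin finS by (auto intro: finite_walks)
  qed
  also have "\<dots> \<le> (\<Sum>S\<in>Pow V. card (walks V R l U S \<times> step_matchings V R S W))"
    by (rule card_UN_le) (use fin in auto)
  also have "\<dots> \<le> (\<Sum>S\<in>Pow V. kernel_power (Pow V) K l U S * K S W)"
    unfolding card_cartesian_product
    by (intro sum_mono mult_mono Suc.IH K) (use Suc.prems in auto)
  finally show ?case by simp
qed

text \<open>In a cyclic matching the sets of vertices matched upwards form a closed walk, so the count is
  bounded by a trace.\<close>

lemma cyclic_matchings_subset_walks:
  assumes R: "R \<subseteq> V \<times> V" and L: "L \<ge> 2"
  shows "cyclic_matchings V R L \<subseteq> (\<Union>U\<in>Pow V. walks V R L U U)"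
proof
  fix M assume "M \<in> cyclic_matchings V R L"
  then have ME: "M \<subseteq> R \<times> {..<L}"
    and cov: "\<And>v j. v \<in> V \<Longrightarrow> j < L \<Longrightarrow> \<exists>!e. e \<in> M \<and> layer_inc L (v, j) e"
    by (auto simp: cyclic_matchings_def matchings_def)
  define S where "S k = fst ` layer M (k mod L)" for k
  have layerR: "layer M k \<subseteq> R" for k using ME by (auto simp: layer_def)
  have SV: "S k \<subseteq> V" for k using layerR R by (force simp: S_def)
  have inc_fst: "layer_inc L (fst r, k) (r, k)" for r k by (simp add: layer_inc_def split: prod.split)
  have inc_snd: "layer_inc L (snd r, Suc k mod L) (r, k)" for r k
    by (simp add: layer_inc_def split: prod.split)
  have uniq: "e = e'" if "e \<in> M" "e' \<in> M" "layer_inc L (v, j) e" "layer_inc L (v, j) e'" "v \<in> V" "j < L" for e e' v j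
    using cov[OF that(5,6)] that(1-4) by blast
  have step: "layer M k \<in> step_matchings V R (S k) (S (Suc k))" if k: "k < L" for k
  proof -
    have V: "fst r \<in> V" "snd r \<in> V" if "r \<in> layer M k" for r k using layerR R that by force+
    have kL: "Suc k mod L < L" "Suc k mod L \<noteq> k"
      using k L by (auto simp: mod_Suc)
    have "inj_on fst (layer M k)"
    proof (rule inj_onI)
      fix r r' assume r: "r \<in> layer M k" "r' \<in> layer M k" "fst r = fst r'"
      then have "(r, k) = (r', k)"
        using uniq[of "(r, k)" "(r', k)" "fst r" k] inc_fst[of r k] inc_fst[of r' k] V[OF r(1)] k
        by (simp add: layer_def)
      then show "r = r'" by simp
    qed
    then have 1: "bij_betw fst (layer M k) (S k)" using k by (simp add: bij_betw_def S_def)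
    have "inj_on snd (layer M k)"
    proof (rule inj_onI)
      fix r r' assume r: "r \<in> layer M k" "r' \<in> layer M k" "snd r = snd r'"
      then have "(r, k) = (r', k)"
        using uniq[of "(r, k)" "(r', k)" "snd r" "Suc k mod L"] inc_snd[of r k] inc_snd[of r' k] V[OF r(1)] kL
        by (simp add: layer_def)
      then show "r = r'" by simp
    qed
    moreover have "snd ` layer M k = V - S (Suc k)"
    proof (intro equalityI subsetI)
      fix v assume "v \<in> snd ` layer M k"
      then obtain r where r: "r \<in> layer M k" "v = snd r" by auto
      have "v \<notin> S (Suc k)"
      proof
        assume "v \<in> S (Suc k)"
        then obtain r' where r': "r' \<in> layer M (Suc k mod L)" "v = fst r'" by (auto simp: S_def)
        have "(r, k) = (r', Suc k mod L)"
          using uniq[of "(r, k)" "(r', Suc k mod L)" v "Suc k mod L"] inc_snd[of r k] inc_fst[of r' "Suc k mod L"]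
            V[OF r(1)] kL r r' by (simp add: layer_def)
        then show False using kL by simp
      qed
      then show "v \<in> V - S (Suc k)" using V[OF r(1)] r by simp
    next
      fix v assume v: "v \<in> V - S (Suc k)"
      obtain r j where e: "(r, j) \<in> M" "layer_inc L (v, Suc k mod L) (r, j)"
        using cov[of v "Suc k mod L"] v kL by (metis DiffD1 prod.exhaust)
      have j: "j < L" using e(1) ME by auto
      have "\<not> (v = fst r \<and> Suc k mod L = j)"
        using e(1) v by (force simp: S_def layer_def)
      then have "v = snd r" "Suc k mod L = Suc j mod L"
        using e(2) by (auto simp: layer_inc_def split: prod.splits)
      moreover have "j = k" using \<open>Suc k mod L = Suc j mod L\<close> j k by (auto simp: mod_Suc split: if_splits)
      ultimately show "v \<in> snd ` layer M k" using e(1) by (force simp: layer_def)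
    qed
    ultimately have 2: "bij_betw snd (layer M k) (V - S (Suc k))" by (simp add: bij_betw_def)
    show ?thesis using 1 2 layerR by (simp add: step_matchings_def)
  qed
  have "M \<in> walks V R L (S 0) (S 0)"
    unfolding walks_def using ME SV step by (intro CollectI conjI exI[of _ S]) (auto simp: S_def)
  then show "M \<in> (\<Union>U\<in>Pow V. walks V R L U U)" using SV by blast
qed

lemma torus_count_le_trace:
  assumes "L \<ge> 2"
  shows "torus_count m n L \<le> (\<Sum>U\<in>Pow (torus m n). kernel_power (Pow (torus m n)) (transfer_entry m n) L U U)"
proof -
  let ?V = "torus m n" and ?R = "step_rel m n"
  have fin: "finite ?V" by (simp add: torus_def)
  have "?R \<subseteq> ?V \<times> ?V" by (auto simp: step_rel_def)
  from cyclic_matchings_subset_walks[OF this assms]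
  have "torus_count m n L \<le> card (\<Union>U\<in>Pow ?V. walks ?V ?R L U U)"
    unfolding torus_count_def using fin finite_step_rel
    by (intro card_mono) (auto intro: finite_walks)
  also have "\<dots> \<le> (\<Sum>U\<in>Pow ?V. card (walks ?V ?R L U U))"
    by (rule card_UN_le) (use fin in auto)
  also have "\<dots> \<le> (\<Sum>U\<in>Pow ?V. kernel_power (Pow ?V) (transfer_entry m n) L U U)"
    by (intro sum_mono card_walks_le_kernel_power fin finite_step_rel card_step_matchings_le_transfer_entry) auto
  finally show ?thesis .
qed

lemma mat_of_set_power_entry:
  assumes I: "finite I" and ij: "i < card I" "j < card I"
  shows "(mat_of_set I (\<lambda>U W. of_nat (K U W) :: complex) ^\<^sub>m l) $$ (i, j)
    = of_nat (kernel_power I K l (from_nat_into I i) (from_nat_into I j))"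
  using ij(2)
proof (induction l arbitrary: j)
  case 0
  have "from_nat_into I i = from_nat_into I j \<longleftrightarrow> i = j"
    using bij_betw_from_nat_into_finite[OF I] ij(1) 0 by (auto simp: bij_betw_def inj_on_def)
  then show ?case using ij(1) 0 by (simp add: mat_of_set_def)
next
  case (Suc l)
  let ?A = "mat_of_set I (\<lambda>U W. of_nat (K U W) :: complex)"
  have A: "?A \<in> carrier_mat (card I) (card I)" by (simp add: mat_of_set_def)
  have Al: "?A ^\<^sub>m l \<in> carrier_mat (card I) (card I)" using A by (rule pow_carrier_mat)
  have "(?A ^\<^sub>m Suc l) $$ (i, j) = (\<Sum>k<card I. (?A ^\<^sub>m l) $$ (i, k) * ?A $$ (k, j))"
    using A Al ij(1) Suc.prems by (simp add: scalar_prod_def atLeast0LessThan)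
  also have "\<dots> = (\<Sum>k<card I. of_nat (kernel_power I K l (from_nat_into I i) (from_nat_into I k)
      * K (from_nat_into I k) (from_nat_into I j)))"
    using Suc.prems by (intro sum.cong refl) (subst Suc.IH, simp_all add: mat_of_set_def[of I])
  also have "\<dots> = (\<Sum>S\<in>I. of_nat (kernel_power I K l (from_nat_into I i) S * K S (from_nat_into I j)))"
    by (rule sum.reindex_bij_betw[OF bij_betw_from_nat_into_finite[OF I]])
  finally show ?case by simp
qed

text \<open>Dividing by \<open>r\<close> makes the spectral radius smaller than one, and the powers of such a matrix are
  bounded.\<close>

lemma norm_pow_mat_le_spectral_radius:
  assumes A: "A \<in> carrier_mat d d" and r: "spectral_radius A < r" "r > 0"
  shows "\<exists>c. \<forall>k. norm_bound (A ^\<^sub>m k) (c * r ^ k)"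
proof (cases "d = 0")
  case True
  then show ?thesis using A by (intro exI[of _ 0]) (auto simp: norm_bound_def)
next
  case False
  define B where "B = complex_of_real (1 / r) \<cdot>\<^sub>m A"
  have B: "B \<in> carrier_mat d d" using A by (simp add: B_def)
  have smult_smult: "a \<cdot>\<^sub>m (b \<cdot>\<^sub>m M) = (a * b) \<cdot>\<^sub>m M" for a b :: complex and M
    by (rule eq_matI) (simp_all add: mult.assoc)
  have Bk: "B ^\<^sub>m k = complex_of_real (1 / r) ^ k \<cdot>\<^sub>m A ^\<^sub>m k" for k
  proof (induction k)
    case (Suc k)
    have Ak: "A ^\<^sub>m k \<in> carrier_mat d d" using A by (rule pow_carrier_mat)
    have "B ^\<^sub>m Suc k = (complex_of_real (1 / r) ^ k \<cdot>\<^sub>m A ^\<^sub>m k) * (complex_of_real (1 / r) \<cdot>\<^sub>m A)"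
      by (simp only: pow_mat.simps Suc B_def[symmetric])
    also have "\<dots> = complex_of_real (1 / r) \<cdot>\<^sub>m ((complex_of_real (1 / r) ^ k \<cdot>\<^sub>m A ^\<^sub>m k) * A)"
      by (rule mult_smult_distrib[of _ d d]) (use A Ak in auto)
    also have "(complex_of_real (1 / r) ^ k \<cdot>\<^sub>m A ^\<^sub>m k) * A = complex_of_real (1 / r) ^ k \<cdot>\<^sub>m (A ^\<^sub>m k * A)"
      by (rule mult_smult_assoc_mat[OF Ak A])
    finally show ?case by (simp add: smult_smult)
  qed (use A B in auto)
  have "spectral_radius B < 1"
  proof -
    obtain b where b: "eigenvalue B b" "spectral_radius B = norm b"
      using spectral_radius_mem_max(1)[OF B] False by (auto simp: spectrum_def)
    then obtain v where v: "v \<in> carrier_vec d" "v \<noteq> 0\<^sub>v d" "B *\<^sub>v v = b \<cdot>\<^sub>v v"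
      using B by (auto simp: eigenvalue_def eigenvector_def)
    have AB: "A = complex_of_real r \<cdot>\<^sub>m B" using r by (intro eq_matI) (auto simp: B_def)
    have "A *\<^sub>v v = complex_of_real r \<cdot>\<^sub>v (B *\<^sub>v v)"
      unfolding AB using B v(1) by (intro eq_vecI) auto
    then have "A *\<^sub>v v = (complex_of_real r * b) \<cdot>\<^sub>v v" by (simp add: v(3) smult_smult_assoc)
    then have "eigenvalue A (complex_of_real r * b)"
      using A v by (auto simp: eigenvalue_def eigenvector_def)
    then have "norm (complex_of_real r * b) \<le> spectral_radius A"
      using spectral_radius_mem_max(2)[OF A] False by (auto simp: spectrum_def)
    moreover have "norm (complex_of_real r * b) = r * norm b" using r by (simp add: norm_mult)
    ultimately have "r * norm b < r * 1" using r(1) by linarith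
    then show ?thesis unfolding b(2) using r(2) mult_less_cancel_left_pos by blast
  qed
  then obtain c where c: "\<And>k. norm_bound (B ^\<^sub>m k) c"
    using spectral_radius_jnf_norm_bound_less_1_upper_triangular[OF B] by blast
  have "norm_bound (A ^\<^sub>m k) (c * r ^ k)" for k
    unfolding norm_bound_def
  proof (intro allI impI)
    fix i j assume ij: "i < dim_row (A ^\<^sub>m k)" "j < dim_col (A ^\<^sub>m k)"
    have "norm ((B ^\<^sub>m k) $$ (i, j)) \<le> c"
      using c[of k] ij unfolding norm_bound_def Bk by simp
    then have "norm ((A ^\<^sub>m k) $$ (i, j)) / r ^ k \<le> c"
      using ij r unfolding Bk by (simp add: norm_mult norm_power norm_divide power_divide)
    then show "norm ((A ^\<^sub>m k) $$ (i, j)) \<le> c * r ^ k"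
      using r by (simp add: pos_divide_le_eq)
  qed
  then show ?thesis by blast
qed

lemma torus_count_exponential_bound:
  assumes r: "spectral_radius (transfer_matrix m n) < r" "r > 0"
  obtains c where "c \<ge> 1" "\<And>L. L \<ge> 2 \<Longrightarrow> real (torus_count m n L) \<le> c * r ^ L"
proof -
  let ?I = "Pow (torus m n)" and ?T = "transfer_matrix m n"
  have I: "finite ?I" by (simp add: torus_def)
  have T: "?T \<in> carrier_mat (card ?I) (card ?I)" by (simp add: transfer_matrix_def mat_of_set_def)
  obtain c where c: "\<And>k. norm_bound (?T ^\<^sub>m k) (c * r ^ k)"
    using norm_pow_mat_le_spectral_radius[OF T r] by blast
  have "real (torus_count m n L) \<le> max 1 (real (card ?I) * c) * r ^ L" if L: "L \<ge> 2" for L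
  proof -
    have entry: "real (kernel_power ?I (transfer_entry m n) L U U) \<le> c * r ^ L" if "U \<in> ?I" for U
    proof -
      obtain i where i: "i < card ?I" "U = from_nat_into ?I i"
        using bij_betw_imp_surj_on[OF bij_betw_from_nat_into_finite[OF I]] \<open>U \<in> ?I\<close> by blast
      have "norm ((?T ^\<^sub>m L) $$ (i, i)) \<le> c * r ^ L"
        using c[of L] i(1) carrier_matD[OF pow_carrier_mat[OF T, of L]] unfolding norm_bound_def by metis
      then show ?thesis
        unfolding transfer_matrix_def mat_of_set_power_entry[OF I i(1) i(1)] i(2) by simp
    qed
    have "real (torus_count m n L) \<le> (\<Sum>U\<in>?I. real (kernel_power ?I (transfer_entry m n) L U U))"
      using torus_count_le_trace[OF L, of m n] by (metis of_nat_le_iff of_nat_sum)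
    also have "\<dots> \<le> (\<Sum>U\<in>?I. c * r ^ L)" by (intro sum_mono entry)
    also have "\<dots> = real (card ?I) * c * r ^ L" by simp
    also have "\<dots> \<le> max 1 (real (card ?I) * c) * r ^ L"
      using r(2) by (intro mult_right_mono) auto
    finally show ?thesis .
  qed
  then show thesis by (intro that[of "max 1 (real (card ?I) * c)"]) auto
qed

section \<open>The limit over boxes\<close>

text \<open>The function and the filter in the definition of the dimer constant.\<close>

definition dimer_density :: "nat \<times> nat \<times> nat \<Rightarrow> real" where
  "dimer_density = (\<lambda>(a1, a2, a3). 1 / real (a1 * a2 * a3) * ln (real (num_dimer_coverings a1 a2 a3)))"

definition large_even_boxes :: "(nat \<times> nat \<times> nat) filter" where
  "large_even_boxes =
    inf (at_top \<times>\<^sub>F at_top \<times>\<^sub>F at_top) (principal {(a1, a2, a3). even (a1 * a2 * a3)})"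

text \<open>The contribution of the copies of the box \<open>(p, q, r)\<close> in \<open>(a, b, c)\<close> to the density of the latter, with
  \<open>a div p\<close> replaced by its lower bound \<open>a / p - 1\<close>, and likewise for the other sides. It tends to the
  density of \<open>(p, q, r)\<close>.\<close>

definition packing_bound :: "nat \<times> nat \<times> nat \<Rightarrow> nat \<times> nat \<times> nat \<Rightarrow> real" where
  "packing_bound = (\<lambda>(p, q, r) (a, b, c). (1 / real p - 1 / real a) * (1 / real q - 1 / real b)
     * (1 / real r - 1 / real c) * ln (real (num_dimer_coverings p q r)))"

lemma real_div_ge:
  assumes "p > 0" "a > 0"
  shows "1 / real p - 1 / real a \<le> real (a div p) / real a"
proof -
  have "a < (a div p + 1) * p"
    using assms(1) div_less_iff_less_mult[of p a "a div p + 1"] by simp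
  then have "real a \<le> (real (a div p) + 1) * real p"
    by (metis (no_types, lifting) of_nat_1 of_nat_add of_nat_le_iff of_nat_mult order_less_imp_le)
  then have "real a - real p \<le> real (a div p) * real p" by (simp add: algebra_simps)
  then have "(real a - real p) / (real a * real p) \<le> real (a div p) * real p / (real a * real p)"
    by (rule divide_right_mono) simp
  moreover have "(real a - real p) / (real a * real p) = 1 / real p - 1 / real a"
    using assms by (simp add: diff_divide_distrib)
  ultimately show ?thesis using assms by simp
qed

lemma packing_bound_le_dimer_density:
  assumes even: "even p" "even q" "even r" and pos: "p > 0" "q > 0" "r > 0"
    and abc: "even (a * b * c)" and le: "p \<le> a" "q \<le> b" "r \<le> c"
  shows "packing_bound (p, q, r) (a, b, c) \<le> dimer_density (a, b, c)"
proof -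
  let ?i = "a div p" and ?j = "b div q" and ?k = "c div r"
  have abc_pos: "a > 0" "b > 0" "c > 0" using pos le by auto
  have N: "num_dimer_coverings p q r \<ge> 1" by (rule num_dimer_coverings_pos) (use even in simp)
  then have ln0: "0 \<le> ln (real (num_dimer_coverings p q r))" by simp
  have nonneg: "0 \<le> 1 / real p - 1 / real a" "0 \<le> 1 / real q - 1 / real b" "0 \<le> 1 / real r - 1 / real c"
    using pos le by (simp_all add: frac_le)
  have "packing_bound (p, q, r) (a, b, c)
      \<le> real ?i / real a * (real ?j / real b) * (real ?k / real c) * ln (real (num_dimer_coverings p q r))"
    unfolding packing_bound_def prod.case
    by (intro mult_mono real_div_ge mult_nonneg_nonneg nonneg ln0 pos abc_pos divide_nonneg_nonneg) auto
  also have "\<dots> = 1 / real (a * b * c) * ln (real (num_dimer_coverings p q r ^ (?i * ?j * ?k)))"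
    using N by (simp add: ln_realpow)
  also have "\<dots> \<le> 1 / real (a * b * c) * ln (real (num_dimer_coverings a b c))"
    by (intro mult_left_mono ln_mono of_nat_mono num_dimer_coverings_ge_power even abc)
      (use N in auto)
  finally show ?thesis by (simp add: dimer_density_def)
qed

text \<open>Doubling all sides reduces boxes of even volume to boxes with even sides.\<close>

lemma dimer_density_le_doubled:
  assumes abc: "even (a * b * c)" and pos: "a > 0" "b > 0" "c > 0"
  shows "dimer_density (a, b, c) \<le> dimer_density (2 * a, 2 * b, 2 * c)"
proof -
  have N: "num_dimer_coverings a b c \<ge> 1" by (rule num_dimer_coverings_pos[OF abc])
  have "8 * ln (real (num_dimer_coverings a b c)) = ln (real (num_dimer_coverings a b c ^ (2 * 2 * 2)))"
    using N by (simp add: ln_realpow)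
  also have "\<dots> \<le> ln (real (num_dimer_coverings (2 * a) (2 * b) (2 * c)))"
    by (intro ln_mono of_nat_mono num_dimer_coverings_power3) (use N in auto)
  finally show ?thesis using pos by (simp add: dimer_density_def field_simps)
qed

lemma filterlim_large_even_boxes:
  "filterlim fst at_top large_even_boxes"
  "filterlim (\<lambda>x. fst (snd x)) at_top large_even_boxes"
  "filterlim (\<lambda>x. snd (snd x)) at_top large_even_boxes"
proof -
  have le: "large_even_boxes \<le> at_top \<times>\<^sub>F at_top \<times>\<^sub>F at_top"
    by (simp add: large_even_boxes_def)
  show "filterlim fst at_top large_even_boxes"
    by (rule filterlim_mono[OF filterlim_fst order_refl le])
  show "filterlim (\<lambda>x. fst (snd x)) at_top large_even_boxes"
    by (rule filterlim_mono[OF filterlim_compose[OF filterlim_fst filterlim_snd] order_refl le])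
  show "filterlim (\<lambda>x. snd (snd x)) at_top large_even_boxes"
    by (rule filterlim_mono[OF filterlim_compose[OF filterlim_snd filterlim_snd] order_refl le])
qed

lemma eventually_large_even_boxes:
  "eventually (\<lambda>(a, b, c). p \<le> a \<and> q \<le> b \<and> r \<le> c \<and> even (a * b * c)) large_even_boxes"
proof -
  have "eventually (\<lambda>x. p \<le> fst x) large_even_boxes" "eventually (\<lambda>x. q \<le> fst (snd x)) large_even_boxes"
    "eventually (\<lambda>x. r \<le> snd (snd x)) large_even_boxes"
    using filterlim_large_even_boxes by (auto simp: filterlim_at_top)
  moreover have "eventually (\<lambda>(a, b, c). even (a * b * c)) large_even_boxes"
    unfolding large_even_boxes_def eventually_inf_principal by (auto intro: always_eventually)
  ultimately show ?thesis by eventually_elim auto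
qed

lemma tendsto_packing_bound:
  "(packing_bound (p, q, r) \<longlongrightarrow> dimer_density (p, q, r)) large_even_boxes"
proof -
  have inv: "((\<lambda>x. 1 / real (f x)) \<longlongrightarrow> 0) F" if "filterlim f at_top F" for f :: "'a \<Rightarrow> nat" and F
    by (rule tendsto_divide_0[OF tendsto_const])
      (rule filterlim_at_top_imp_at_infinity[OF filterlim_compose[OF filterlim_real_sequentially that]])
  have "((\<lambda>x. (1 / real p - 1 / real (fst x)) * (1 / real q - 1 / real (fst (snd x)))
      * (1 / real r - 1 / real (snd (snd x))) * ln (real (num_dimer_coverings p q r)))
    \<longlongrightarrow> (1 / real p - 0) * (1 / real q - 0) * (1 / real r - 0) * ln (real (num_dimer_coverings p q r)))
    large_even_boxes"
    by (intro tendsto_intros inv filterlim_large_even_boxes)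
  then show ?thesis
    by (simp add: packing_bound_def dimer_density_def case_prod_beta' mult.assoc)
qed

section \<open>Boxes obtained by repeated doubling\<close>

text \<open>A sequence of boxes which grow in all directions and whose first two sides arise from \<open>m\<close> and \<open>n\<close> by
  doubling. The third side is even already for \<open>i = 0\<close>.\<close>

definition doubling_boxes :: "nat \<Rightarrow> nat \<Rightarrow> nat \<Rightarrow> nat \<times> nat \<times> nat" where
  "doubling_boxes m n i = (m * 2 ^ i, n * 2 ^ i, 2 ^ Suc i)"

lemma filterlim_doubling_boxes:
  assumes "m > 0" "n > 0"
  shows "filterlim (doubling_boxes m n) large_even_boxes sequentially"
proof -
  have lim: "filterlim f at_top sequentially" if "\<And>i. 2 ^ i \<le> f i" for f :: "nat \<Rightarrow> nat"
  proof (rule filterlim_at_top_mono[OF filterlim_ident])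
    have "i \<le> f i" for i using less_exp[of i] that[of i] by linarith
    then show "eventually (\<lambda>i. i \<le> f i) sequentially" by simp
  qed
  have "filterlim (\<lambda>i. (m * 2 ^ i, n * 2 ^ i, 2 ^ Suc i :: nat)) (at_top \<times>\<^sub>F at_top \<times>\<^sub>F at_top) sequentially"
    by (intro filterlim_Pair lim) (use assms in auto)
  then show ?thesis
    unfolding large_even_boxes_def filterlim_inf filterlim_principal doubling_boxes_def[abs_def] by simp
qed

lemma large_even_boxes_not_bot: "large_even_boxes \<noteq> bot"
proof
  assume "large_even_boxes = bot"
  then have "filtermap (doubling_boxes 1 1) sequentially = bot"
    using filterlim_doubling_boxes[of 1 1] by (simp add: filterlim_def bot_unique)
  then show False by (simp add: filtermap_bot_iff)
qed

text \<open>The limit exists and is the supremum \<open>s\<close> of the densities of boxes with even sides. Packing shows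
  that the densities eventually exceed every number below \<open>s\<close>, and doubling shows that no density
  exceeds \<open>s\<close>. The hypothesis also ensures that the supremum is finite.\<close>

lemma dimer_constant_le:
  assumes bound: "\<And>p q r. even p \<Longrightarrow> even q \<Longrightarrow> even r \<Longrightarrow> p > 0 \<Longrightarrow> q > 0 \<Longrightarrow> r > 0
    \<Longrightarrow> dimer_density (p, q, r) \<le> B"
  shows "dimer_constant \<le> B"
proof -
  define S :: "(nat \<times> nat \<times> nat) set"
    where "S = {(p, q, r). even p \<and> even q \<and> even r \<and> p > 0 \<and> q > 0 \<and> r > 0}"
  define s where "s = (SUP x\<in>S. dimer_density x)"
  have S: "S \<noteq> {}" by (auto simp: S_def intro!: exI[of _ 2])
  have bdd: "bdd_above (dimer_density ` S)"
    by (rule bdd_aboveI2[of _ _ B]) (auto simp: S_def bound)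
  have sB: "s \<le> B" unfolding s_def by (rule cSUP_least[OF S]) (auto simp: S_def bound)
  have "(dimer_density \<longlongrightarrow> s) large_even_boxes"
  proof (rule order_tendstoI)
    fix y assume "y < s"
    then obtain p q r where pqr: "(p, q, r) \<in> S" "y < dimer_density (p, q, r)"
      unfolding s_def less_cSUP_iff[OF S bdd] by (metis prod_cases3)
    have "eventually (\<lambda>x. y < packing_bound (p, q, r) x) large_even_boxes"
      by (rule order_tendstoD(1)[OF tendsto_packing_bound pqr(2)])
    then show "eventually (\<lambda>x. y < dimer_density x) large_even_boxes"
      using eventually_large_even_boxes[of p q r]
    proof eventually_elim
      case (elim x)
      obtain a b c where x: "x = (a, b, c)" by (rule prod_cases3)
      have "packing_bound (p, q, r) x \<le> dimer_density x"
        using pqr(1) elim(2) unfolding x S_def by (intro packing_bound_le_dimer_density) auto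
      then show ?case using elim(1) by simp
    qed
  next
    fix y assume y: "s < y"
    show "eventually (\<lambda>x. dimer_density x < y) large_even_boxes"
      using eventually_large_even_boxes[of 1 1 1]
    proof eventually_elim
      case (elim x)
      obtain a b c where x: "x = (a, b, c)" by (rule prod_cases3)
      have abc: "even (a * b * c)" "a > 0" "b > 0" "c > 0" using elim unfolding x by auto
      have "dimer_density x \<le> dimer_density (2 * a, 2 * b, 2 * c)"
        unfolding x by (rule dimer_density_le_doubled[OF abc])
      also have "\<dots> \<le> s"
        unfolding s_def by (rule cSUP_upper[OF _ bdd]) (use abc in \<open>simp add: S_def\<close>)
      finally show ?case using y by simp
    qed
  qed
  then have "Lim large_even_boxes dimer_density = s"
    by (rule tendsto_Lim[OF large_even_boxes_not_bot])
  then show ?thesis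
    using sB by (simp add: dimer_constant_def dimer_density_def large_even_boxes_def)
qed

lemma torus_count_doubling_le:
  assumes mn: "m \<ge> 2" "n \<ge> 2" and L: "even L"
  shows "torus_count (m * 2 ^ i) (n * 2 ^ i) L \<le> torus_count m n L ^ (4 ^ i)"
proof (induction i)
  case (Suc i)
  have ge: "m * 2 ^ i \<ge> 2" "n * 2 ^ i \<ge> 2" "2 * (m * 2 ^ i) \<ge> 2"
    using mn by (simp_all add: le_trans[OF mn(1)] le_trans[OF mn(2)])
  have "torus_count (m * 2 ^ Suc i) (n * 2 ^ Suc i) L = torus_count (2 * (m * 2 ^ i)) (2 * (n * 2 ^ i)) L"
    by (simp add: mult_ac)
  also have "\<dots> \<le> (torus_count (2 * (m * 2 ^ i)) (n * 2 ^ i) L)\<^sup>2"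
    by (rule torus_count_double(2)[OF ge(3,2) L])
  also have "\<dots> \<le> ((torus_count (m * 2 ^ i) (n * 2 ^ i) L)\<^sup>2)\<^sup>2"
    by (intro power_mono torus_count_double(1)[OF ge(1,2) L]) simp
  also have "\<dots> \<le> ((torus_count m n L ^ (4 ^ i))\<^sup>2)\<^sup>2"
    by (intro power_mono Suc.IH) simp_all
  also have "\<dots> = torus_count m n L ^ (4 ^ Suc i)"
    by (simp add: power_mult[symmetric] mult_ac)
  finally show ?case .
qed simp

lemma dimer_density_doubling_boxes_le:
  assumes mn: "m \<ge> 2" "n \<ge> 2" and r: "r > 0" and c: "c \<ge> 1"
    and bound: "\<And>L. L \<ge> 2 \<Longrightarrow> real (torus_count m n L) \<le> c * r ^ L"
  shows "dimer_density (doubling_boxes m n i) \<le> ln c / real (m * n) * (1 / 2 ^ Suc i) + ln r / real (m * n)"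
proof -
  define L :: nat where "L = 2 ^ Suc i"
  have L: "even L" "L \<ge> 2" by (simp_all add: L_def)
  define N where "N = num_dimer_coverings (m * 2 ^ i) (n * 2 ^ i) L"
  have N1: "N \<ge> 1" unfolding N_def by (rule num_dimer_coverings_pos) (use L in simp)
  have ge: "m * 2 ^ i \<ge> 2" "n * 2 ^ i \<ge> 2"
    using mn by (simp_all add: le_trans[OF mn(1)] le_trans[OF mn(2)])
  have "N \<le> torus_count m n L ^ (4 ^ i)"
    unfolding N_def using num_dimer_coverings_le_torus_count[OF ge L(2)] torus_count_doubling_le[OF mn L(1)]
    by (rule le_trans)
  then have "real N \<le> real (torus_count m n L) ^ (4 ^ i)" by (metis of_nat_le_iff of_nat_power)
  also have "\<dots> \<le> (c * r ^ L) ^ (4 ^ i)" by (intro power_mono bound L) simp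
  finally have "ln (real N) \<le> ln ((c * r ^ L) ^ (4 ^ i))" using N1 by (intro ln_mono) auto
  also have "\<dots> = 4 ^ i * (ln c + real L * ln r)"
    using r c by (simp add: ln_realpow ln_mult)
  finally have "ln (real N) / (4 ^ i * (real (m * n) * real L))
      \<le> 4 ^ i * (ln c + real L * ln r) / (4 ^ i * (real (m * n) * real L))"
    by (rule divide_right_mono) simp
  also have "4 ^ i * (ln c + real L * ln r) / (4 ^ i * (real (m * n) * real L))
      = ln c / real (m * n) * (1 / real L) + ln r / real (m * n)"
    using mn L by (simp add: field_simps)
  finally have "ln (real N) / (4 ^ i * (real (m * n) * real L)) \<le> ln c / real (m * n) * (1 / real L) + ln r / real (m * n)" .
  moreover have "dimer_density (doubling_boxes m n i) = ln (real N) / real (m * 2 ^ i * (n * 2 ^ i) * L)"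
    unfolding dimer_density_def doubling_boxes_def N_def L_def prod.case by simp
  moreover have "real (m * 2 ^ i * (n * 2 ^ i) * L) = 4 ^ i * (real (m * n) * real L)"
    by (simp add: power_mult_distrib[symmetric] mult_ac)
  moreover have "real L = 2 ^ Suc i" by (simp add: L_def)
  ultimately show ?thesis by (simp only:)
qed

text \<open>The density of \<open>(p, q, r)\<close> is the limit of its packing bounds in the doubling boxes, whose densities
  are bounded through the torus. The constant \<open>c\<close> disappears since the number of levels grows.\<close>

lemma dimer_density_le_ln_spectral_bound:
  assumes mn: "m \<ge> 2" "n \<ge> 2" and t: "spectral_radius (transfer_matrix m n) < t" "t > 0"
    and pqr: "even p" "even q" "even r" "p > 0" "q > 0" "r > 0"
  shows "dimer_density (p, q, r) \<le> ln t / real (m * n)"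
proof -
  obtain c where c: "c \<ge> 1" "\<And>L. L \<ge> 2 \<Longrightarrow> real (torus_count m n L) \<le> c * t ^ L"
    using torus_count_exponential_bound[OF t] by blast
  have lim: "filterlim (doubling_boxes m n) large_even_boxes sequentially"
    by (rule filterlim_doubling_boxes) (use mn in auto)
  have lower: "((\<lambda>i. packing_bound (p, q, r) (doubling_boxes m n i)) \<longlongrightarrow> dimer_density (p, q, r)) sequentially"
    by (rule filterlim_compose[OF tendsto_packing_bound lim])
  have "(\<lambda>i. (1 / 2 :: real) ^ Suc i) \<longlonglongrightarrow> 0"
    by (intro LIMSEQ_Suc LIMSEQ_power_zero) simp
  then have "(\<lambda>i. ln c / real (m * n) * (1 / 2) ^ Suc i + ln t / real (m * n))
      \<longlonglongrightarrow> ln c / real (m * n) * 0 + ln t / real (m * n)"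
    by (intro tendsto_intros)
  then have upper: "(\<lambda>i. ln c / real (m * n) * (1 / 2 ^ Suc i) + ln t / real (m * n)) \<longlonglongrightarrow> ln t / real (m * n)"
    by (simp add: power_one_over)
  have "eventually (\<lambda>i. (case doubling_boxes m n i of (a, b, c) \<Rightarrow> p \<le> a \<and> q \<le> b \<and> r \<le> c \<and> even (a * b * c)))
      sequentially"
    by (rule eventually_compose_filterlim[OF eventually_large_even_boxes lim])
  then have "eventually (\<lambda>i. packing_bound (p, q, r) (doubling_boxes m n i)
      \<le> ln c / real (m * n) * (1 / 2 ^ Suc i) + ln t / real (m * n)) sequentially"
  proof eventually_elim
    case (elim i)
    obtain a b d where x: "doubling_boxes m n i = (a, b, d)" by (rule prod_cases3)
    have "packing_bound (p, q, r) (doubling_boxes m n i) \<le> dimer_density (doubling_boxes m n i)"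
      using pqr elim unfolding x by (intro packing_bound_le_dimer_density) auto
    also have "\<dots> \<le> ln c / real (m * n) * (1 / 2 ^ Suc i) + ln t / real (m * n)"
      by (rule dimer_density_doubling_boxes_le[OF mn t(2) c])
    finally show ?case .
  qed
  then show ?thesis by (rule tendsto_le[OF sequentially_bot upper lower])
qed

section \<open>The bound by the spectral radius\<close>

theorem theorem2p1:
  fixes m n :: nat
  assumes "m \<ge> 2" and "n \<ge> 2"
  shows "dimer_constant \<le> 1 / real (m * n) * ln (spectral_radius (transfer_matrix m n))"
proof (rule dimer_constant_le)
  let ?\<rho> = "spectral_radius (transfer_matrix m n)"
  fix p q r :: nat assume pqr: "even p" "even q" "even r" "p > 0" "q > 0" "r > 0"
  have mn: "real (m * n) > 0" using assms by simp
  have le: "dimer_density (p, q, r) \<le> ln t / real (m * n)" if "?\<rho> < t" "t > 0" for t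
    by (rule dimer_density_le_ln_spectral_bound[OF assms that pqr])
  have "num_dimer_coverings p q r \<ge> 1" by (rule num_dimer_coverings_pos) (use pqr in simp)
  then have nonneg: "0 \<le> dimer_density (p, q, r)" by (simp add: dimer_density_def)
  \<comment> \<open>Otherwise \<open>t = 1 / 2\<close> would be admissible, but densities are nonnegative.\<close>
  have \<rho>: "?\<rho> > 0"
  proof (rule ccontr)
    assume "\<not> ?\<rho> > 0"
    then have "0 \<le> ln (1 / 2) / real (m * n)" using le[of "1 / 2"] nonneg by linarith
    moreover have "ln (1 / 2 :: real) < 0" by simp
    ultimately show False using mn by (simp add: zero_le_divide_iff)
  qed
  have "(\<lambda>k. ln (?\<rho> + 1 / real (Suc k)) / real (m * n)) \<longlonglongrightarrow> ln (?\<rho> + 0) / real (m * n)"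
    by (intro tendsto_intros LIMSEQ_Suc[OF lim_1_over_n]) (use assms \<rho> in auto)
  then have "dimer_density (p, q, r) \<le> ln (?\<rho> + 0) / real (m * n)"
    by (rule LIMSEQ_le_const) (use le \<rho> in \<open>auto intro!: exI[of _ 0] add_pos_pos\<close>)
  then show "dimer_density (p, q, r) \<le> 1 / real (m * n) * ln ?\<rho>" by simp
qed

end
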